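(* Let $n\ge 2$ and let $f\colon\mathbb{R}^n\to\mathbb{R}$ be a $C^4$-differentiable function whose graph $G_f=\{(x,f(x))\,;\,x\in\mathbb{R}^n\}$ is a zero mean curvature graph in the Lorentz-Minkowski space $\mathbb{R}^{n+1}_1$, i.e. $A_f=0$ identically on $\mathbb{R}^n$. If $G_f$ does not admit any time-like points, i.e. $B_f\ge 0$ everywhere on $\mathbb{R}^n$, then $G_f$ is a hyperplane in $\mathbb{R}^{n+1}_1$.
   Context: $\mathbb{R}^{n+1}_1$ ($n\ge 2$) denotes the Lorentz-Minkowski $(n+1)$-space of signature $(+\cdots+-)$, i.e. $\mathbb{R}^{n+1}$ with the inner product $x_1y_1+\cdots+x_ny_n-x_{n+1}y_{n+1}$. For a function $f$ of class at least $C^2$ on a domain $\Omega\subset\mathbb{R}^n$, with $f_{x_i}=\partial f/\partial x_i$, $f_{x_i,x_j}=\partial^2 f/\partial x_i\partial x_j$ and $\delta_{i,j}$ the Kronecker delta, put $$B_f:=1-f_{x_1}^2-\cdots-f_{x_n}^2,\qquad A_f:=\sum_{i,j=1}^n (B_f\delta_{i,j}+f_{x_i}f_{x_j})f_{x_i,x_j}.$$ The graph $G_f=\{(x,f(x))\in\mathbb{R}^{n+1}_1\,;\,x\in\Omega\}$ is called a zero mean curvature graph (ZMC-graph) if $A_f$ vanishes identically on $\Omega$, and is called entire if $\Omega=\mathbb{R}^n$. A point of $\Omega$ where $B_f>0$ (resp. $B_f<0$, $B_f=0$) is called a space-like (resp. time-like, light-like) point of $G_f$. A hyperplane means an affine hyperplane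 of $\mathbb{R}^{n+1}$. *)

theory Defs
  imports "HOL-Analysis.Analysis"
begin

definition partial :: "'n \<Rightarrow> (real ^ 'n \<Rightarrow> real) \<Rightarrow> real ^ 'n \<Rightarrow> real" where
  "partial i f x = deriv (\<lambda>t. f (x + t *\<^sub>R axis i 1)) 0"

(* deriv is an unspecified value where the derivative does not exist, so the existence of
   each partial derivative is required explicitly.  Meant for open \<Omega>. *)
fun Ck_on :: "nat \<Rightarrow> (real ^ 'n) set \<Rightarrow> (real ^ 'n \<Rightarrow> real) \<Rightarrow> bool" where
  "Ck_on 0 \<Omega> f \<longleftrightarrow> continuous_on \<Omega> f"
| "Ck_on (Suc k) \<Omega> f \<longleftrightarrow> continuous_on \<Omega> f \<and>
     (\<forall>i. (\<forall>x\<in>\<Omega>. (\<lambda>t. f (x + t *\<^sub>R axis i 1)) field_differentiable (at 0)) \<and>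
          Ck_on k \<Omega> (partial i f))"

definition B_fun :: "(real ^ 'n \<Rightarrow> real) \<Rightarrow> real ^ 'n \<Rightarrow> real" where
  "B_fun f x = 1 - (\<Sum>i\<in>UNIV. (partial i f x)\<^sup>2)"

definition A_fun :: "(real ^ 'n \<Rightarrow> real) \<Rightarrow> real ^ 'n \<Rightarrow> real" where
  "A_fun f x = (\<Sum>i\<in>UNIV. \<Sum>j\<in>UNIV.
     (B_fun f x * (if i = j then 1 else 0) + partial i f x * partial j f x)
       * partial j (partial i f) x)"

(* Lorentz-Minkowski (n+1)-space is modelled on (real ^ 'n) \<times> real, the last factor being the
   time-like coordinate. *)
definition graph_on :: "(real ^ 'n) set \<Rightarrow> (real ^ 'n \<Rightarrow> real) \<Rightarrow> ((real ^ 'n) \<times> real) set" where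
  "graph_on \<Omega> f = {(x, f x) | x. x \<in> \<Omega>}"

definition zmc_graph_on :: "(real ^ 'n) set \<Rightarrow> (real ^ 'n \<Rightarrow> real) \<Rightarrow> bool" where
  "zmc_graph_on \<Omega> f \<longleftrightarrow> (\<forall>x\<in>\<Omega>. A_fun f x = 0)"

definition time_like_point :: "(real ^ 'n \<Rightarrow> real) \<Rightarrow> real ^ 'n \<Rightarrow> bool" where
  "time_like_point f x \<longleftrightarrow> B_fun f x < 0"

(* An affine hyperplane does not depend on the metric: the Euclidean inner product below only
   serves to write down the nonzero linear functionals. *)
definition affine_hyperplane :: "'a :: euclidean_space set \<Rightarrow> bool" where
  "affine_hyperplane H \<longleftrightarrow> (\<exists>a b. a \<noteq> 0 \<and> H = {p. a \<bullet> p = b})"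

end

theory Submission
  imports Defs
begin

text \<open>Write p = Df and B = 1 - |p|^2. The argument depends on whether B vanishes somewhere.

Suppose B vanishes at a point x0, and let e = Df(x0), a unit vector. Since the gradient of B is
-2 D^2f p, the equation A = 0 reads <p, DB> = 2 B (trace D^2f), and since B is nowhere negative,
|DB|^2 is locally bounded by a multiple of B. Along the line x0 + t e these two facts give the
linear differential inequality |Q'| \<le> C Q for Q = B + |e - p|^2. As Q vanishes at t = 0, it
vanishes on the whole line, so f grows along it with slope 1 (light_like_line). But f is
1-Lipschitz, and a 1-Lipschitz function that attains this slope along a complete line is affine
(affine_if_light_like_point).

Suppose B > 0 everywhere. Then the graph is an entire maximal hypersurface, and the claim is the
Bernstein theorem of Calabi and of Cheng and Yau; it is proved here by maximum principles alone.
On a maximal graph the coordinate functions are harmonic, so the Laplace-Beltrami operator has in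
the coordinates of the base no first-order part. With f(0) = 0, let r be the Lorentzian square
distance |x|^2 - f^2 from the origin, w the support function and F = |A|^2 the squared norm of the
second fundamental form. Then

  \<^item> the sublevel sets of r are compact, because f is strictly 1-Lipschitz (r_sublevel_compact);
  \<^item> lap r = 2n and |grad r|^2 = 4 (r + w^2), while lap w = F w (lap_r, gam_r_r, lap_w);
  \<^item> lap F \<ge> 2 F^2, which is the inequality of Simons type (simons).

At a maximum of (\<rho> - r)^m w^2 the gradient of r is a principal direction; as the shape operator
has trace zero, its eigenvalue is controlled by F with a constant better than the trivial one, and
this yields w^2 \<le> C \<rho> where r \<le> \<rho> (support_bound). So |grad r|^2 is at most a multiple of
\<rho> there, and a maximum of (\<rho> - r)^2 F shows that (\<rho> - r)^2 F \<le> D \<rho>. Letting \<rho> tend to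
infinity gives F = 0 (F_zero), hence D^2f = 0.\<close>

section \<open>Functions with continuous partial derivatives\<close>

abbreviation (input) Ck :: "nat \<Rightarrow> (real ^ 'n \<Rightarrow> real) \<Rightarrow> bool" where
  "Ck k \<equiv> Ck_on k UNIV"

lemma Ck_Suc_D: "Ck (Suc k) u \<Longrightarrow> Ck k u"
  by (induction k arbitrary: u) auto

lemma Ck_mono: "Ck m u \<Longrightarrow> k \<le> m \<Longrightarrow> Ck k u"
  by (induction m) (auto simp: le_Suc_eq intro: Ck_Suc_D simp del: Ck_on.simps)

lemma Ck_partial: "Ck (Suc k) u \<Longrightarrow> Ck k (partial i u)"
  by simp

lemma Ck_continuous: "Ck k u \<Longrightarrow> continuous_on UNIV u"
  by (cases k) auto

lemma has_partial:
  assumes "Ck (Suc k) u"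
  shows "((\<lambda>t. u (x + t *\<^sub>R axis i 1)) has_real_derivative partial i u (x + t *\<^sub>R axis i 1)) (at t)"
proof -
  have "((\<lambda>s. u ((x + t *\<^sub>R axis i 1) + s *\<^sub>R axis i 1)) has_real_derivative
      partial i u (x + t *\<^sub>R axis i 1)) (at 0)"
    using assms by (auto simp: partial_def field_differentiable_derivI)
  then have "((\<lambda>s. u (x + (s + t) *\<^sub>R axis i 1)) has_real_derivative
      partial i u (x + t *\<^sub>R axis i 1)) (at 0)"
    by (simp add: algebra_simps)
  then show ?thesis
    using DERIV_shift[of "\<lambda>s. u (x + s *\<^sub>R axis i 1)" _ 0 t] by simp
qed

lemma partial_eqI:
  "((\<lambda>t. u (x + t *\<^sub>R axis i 1)) has_real_derivative d) (at 0) \<Longrightarrow> partial i u x = d"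
  by (simp add: partial_def DERIV_imp_deriv)

text \<open>Coordinates are changed one at a time, A being the set of those already changed; the mean value
  theorem bounds each step by the oscillation of a single partial derivative.\<close>

lemma increment_bound:
  fixes u :: "real ^ 'n \<Rightarrow> real"
  assumes u: "Ck (Suc k) u"
    and near: "\<And>y i. norm (y - x) \<le> norm h \<Longrightarrow> \<bar>partial i u y - partial i u x\<bar> \<le> e"
  shows "\<bar>u (x + (\<chi> i. if i \<in> A then h $ i else 0)) - u x - (\<Sum>i\<in>A. h $ i * partial i u x)\<bar>
          \<le> e * (\<Sum>i\<in>A. \<bar>h $ i\<bar>)"
proof (induction A rule: finite_induct[OF finite])
  case 1
  have "(\<chi> i. 0) = (0 :: real ^ 'n)" by (simp add: vec_eq_iff)
  then show ?case by simp
next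
  case (2 j A)
  let ?a = "\<chi> i. if i \<in> A then h $ i else 0"
  have split: "(\<chi> i. if i \<in> insert j A then h $ i else 0) = ?a + (h $ j) *\<^sub>R axis j 1"
    using 2 by (auto simp: vec_eq_iff axis_def)
  have near': "\<bar>partial j u (x + ?a + t *\<^sub>R axis j 1) - partial j u x\<bar> \<le> e"
    if "t \<in> closed_segment 0 (h $ j)" for t
  proof (rule near)
    have "\<bar>t\<bar> \<le> \<bar>h $ j\<bar>"
      using that by (auto simp: closed_segment_eq_real_ivl split: if_splits)
    then have "norm (?a + t *\<^sub>R axis j 1) \<le> norm h"
      using 2 by (intro norm_le_componentwise_cart) (auto simp: axis_def)
    then show "norm (x + ?a + t *\<^sub>R axis j 1 - x) \<le> norm h"
      by (simp add: algebra_simps)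
  qed
  have "norm ((u (x + ?a + (h $ j) *\<^sub>R axis j 1) - (h $ j) * partial j u x)
        - (u (x + ?a + 0 *\<^sub>R axis j 1) - 0 * partial j u x)) \<le> e * norm (h $ j - 0)"
    by (rule field_differentiable_bound[where S = "closed_segment 0 (h $ j)"
          and f' = "\<lambda>t. partial j u (x + ?a + t *\<^sub>R axis j 1) - partial j u x"
          and f = "\<lambda>t. u (x + ?a + t *\<^sub>R axis j 1) - t * partial j u x"])
       (auto intro!: derivative_eq_intros has_field_derivative_at_within[OF has_partial[OF u]] near')
  then show ?case
    using 2 unfolding split by (simp add: add.assoc algebra_simps)
qed

text \<open>The definition of the class Ck only speaks of derivatives along the axes. Their continuity gives
  total differentiability, and with it derivatives along arbitrary lines.\<close>

lemma has_derivative_partials: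
  fixes u :: "real ^ 'n \<Rightarrow> real"
  assumes u: "Ck (Suc k) u"
  shows "(u has_derivative (\<lambda>h. \<Sum>i\<in>UNIV. h $ i * partial i u x)) (at x)"
  unfolding has_derivative_at_alt
proof (intro conjI allI impI)
  show "bounded_linear (\<lambda>h. \<Sum>i\<in>UNIV. h $ i * partial i u x)"
    by (intro bounded_linear_sum bounded_linear_mult_left[THEN bounded_linear_compose]
        bounded_linear_vec_nth)
next
  fix e :: real assume e: "e > 0"
  define e' where "e' = e / CARD('n)"
  have e': "e' > 0" using e by (simp add: e'_def)
  have "\<forall>\<^sub>F y in nhds x. \<forall>i. dist (partial i u y) (partial i u x) < e'"
  proof (rule eventually_all_finite)
    fix i
    have "isCont (partial i u) x"
      using Ck_continuous[OF Ck_partial[OF u]] by (simp add: continuous_on_eq_continuous_at)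
    then show "\<forall>\<^sub>F y in nhds x. dist (partial i u y) (partial i u x) < e'"
      using e' by (auto simp: isCont_def tendsto_iff eventually_at_filter elim!: allE[of _ e'] elim: eventually_mono)
  qed
  then obtain d where d: "d > 0" "\<And>y i. dist y x < d \<Longrightarrow> dist (partial i u y) (partial i u x) < e'"
    by (auto simp: eventually_nhds_metric)
  show "\<exists>d>0. \<forall>y. norm (y - x) < d \<longrightarrow>
    norm (u y - u x - (\<Sum>i\<in>UNIV. (y - x) $ i * partial i u x)) \<le> e * norm (y - x)"
  proof (intro exI[of _ d] conjI allI impI)
    fix y assume y: "norm (y - x) < d"
    have "\<bar>u (x + (\<chi> i. if i \<in> UNIV then (y - x) $ i else 0)) - u x
            - (\<Sum>i\<in>UNIV. (y - x) $ i * partial i u x)\<bar> \<le> e' * (\<Sum>i\<in>UNIV. \<bar>(y - x) $ i\<bar>)"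
      using u e' y d(2) by (intro increment_bound) (auto simp: dist_norm less_imp_le)
    moreover have "x + (\<chi> i. if i \<in> UNIV then (y - x) $ i else 0) = y"
      by (simp add: vec_eq_iff)
    moreover have "(\<Sum>i\<in>UNIV. \<bar>(y - x) $ i\<bar>) \<le> CARD('n) * norm (y - x)"
      by (intro sum_bounded_above component_le_norm_cart)
    then have "e' * (\<Sum>i\<in>UNIV. \<bar>(y - x) $ i\<bar>) \<le> e' * (CARD('n) * norm (y - x))"
      using e' by (intro mult_left_mono) auto
    moreover have "e' * (CARD('n) * norm (y - x)) = e * norm (y - x)"
      by (simp add: e'_def)
    ultimately show "norm (u y - u x - (\<Sum>i\<in>UNIV. (y - x) $ i * partial i u x)) \<le> e * norm (y - x)"
      by simp
  qed (fact d)
qed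

lemma has_derivative_line:
  fixes u :: "real ^ 'n \<Rightarrow> real"
  assumes u: "Ck (Suc k) u"
  shows "((\<lambda>t. u (x + t *\<^sub>R d)) has_real_derivative
           (\<Sum>i\<in>UNIV. d $ i * partial i u (x + t *\<^sub>R d))) (at t)"
proof -
  have "((\<lambda>t. x + t *\<^sub>R d) has_derivative (\<lambda>s. s *\<^sub>R d)) (at t)"
    by (auto intro!: derivative_eq_intros)
  from has_derivative_compose[OF this has_derivative_partials[OF u]]
  show ?thesis
    by (rule has_derivative_imp_has_field_derivative)
       (simp add: sum_distrib_left sum_distrib_right mult_ac)
qed

subsection \<open>Rules for partial derivatives\<close>

lemma partial_const [simp]: "partial i (\<lambda>x. c) = (\<lambda>x. 0)"
  by (intro ext partial_eqI) auto

lemma has_partial0: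
  assumes "Ck (Suc k) u"
  shows "((\<lambda>t. u (x + t *\<^sub>R axis i 1)) has_real_derivative partial i u x) (at 0)"
  using has_partial[OF assms, of x i 0] by simp

lemma partial_coord: "partial i (\<lambda>x. x $ j) = (\<lambda>x. if i = j then 1 else 0)"
  by (intro ext partial_eqI) (auto intro!: derivative_eq_intros simp: axis_def)

lemma partial_add:
  assumes "Ck (Suc k) u" "Ck (Suc m) w"
  shows "partial i (\<lambda>x. u x + w x) = (\<lambda>x. partial i u x + partial i w x)"
  by (intro ext partial_eqI) (auto intro!: derivative_eq_intros has_partial0[OF assms(1)] has_partial0[OF assms(2)])

lemma partial_diff:
  assumes "Ck (Suc k) u" "Ck (Suc m) w"
  shows "partial i (\<lambda>x. u x - w x) = (\<lambda>x. partial i u x - partial i w x)"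
  by (intro ext partial_eqI) (auto intro!: derivative_eq_intros has_partial0[OF assms(1)] has_partial0[OF assms(2)])

lemma partial_mult:
  assumes "Ck (Suc k) u" "Ck (Suc m) w"
  shows "partial i (\<lambda>x. u x * w x) = (\<lambda>x. partial i u x * w x + u x * partial i w x)"
  by (intro ext partial_eqI) (auto intro!: derivative_eq_intros has_partial0[OF assms(1)] has_partial0[OF assms(2)])

lemma partial_sum:
  assumes "\<And>j. j \<in> A \<Longrightarrow> Ck (Suc k) (u j)"
  shows "partial i (\<lambda>x. \<Sum>j\<in>A. u j x) = (\<lambda>x. \<Sum>j\<in>A. partial i (u j) x)"
  by (intro ext partial_eqI) (auto intro!: derivative_eq_intros has_partial0[OF assms])

lemma partial_power:
  assumes "Ck (Suc k) u"
  shows "partial i (\<lambda>x. u x ^ m) = (\<lambda>x. real m * u x ^ (m - 1) * partial i u x)"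
  by (intro ext partial_eqI)
     (auto intro!: derivative_eq_intros has_partial0[OF assms(1)])

lemma partial_powr:
  assumes "Ck (Suc k) u" "\<And>x. u x > 0"
  shows "partial i (\<lambda>x. u x powr a) = (\<lambda>x. a * u x powr (a - 1) * partial i u x)"
  by (intro ext partial_eqI)
     (auto intro!: derivative_eq_intros has_partial0[OF assms(1)] simp: assms(2) has_real_derivative_powr
       simp: powr_diff field_simps)

subsection \<open>Closure properties\<close>

lemma Ck_Suc_iff:
  "Ck (Suc k) u \<longleftrightarrow> continuous_on UNIV u \<and>
    (\<forall>i x. \<exists>d. ((\<lambda>t. u (x + t *\<^sub>R axis i 1)) has_real_derivative d) (at 0)) \<and> (\<forall>i. Ck k (partial i u))"
  by (auto simp: field_differentiable_def)

lemma Ck_const [intro]: "Ck k (\<lambda>x. c)"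
  by (induction k arbitrary: c) auto

lemma Ck_coord [intro]: "Ck k (\<lambda>x. x $ j)"
proof (cases k)
  case (Suc m)
  show ?thesis
    unfolding Suc Ck_Suc_iff
    by (auto simp: partial_coord intro!: continuous_intros exI derivative_eq_intros)
qed (auto intro!: continuous_intros)

lemma Ck_add [intro]: "Ck k u \<Longrightarrow> Ck k w \<Longrightarrow> Ck k (\<lambda>x. u x + w x)"
proof (induction k arbitrary: u w)
  case (Suc k)
  have "\<exists>d. ((\<lambda>t. u (x + t *\<^sub>R axis i 1) + w (x + t *\<^sub>R axis i 1)) has_real_derivative d) (at 0)" for x i
    using DERIV_add[OF has_partial0[OF Suc.prems(1)] has_partial0[OF Suc.prems(2)]] by blast
  then show ?case
    using Suc.IH Suc.prems[THEN Ck_partial] Suc.prems[THEN Ck_continuous] partial_add[OF Suc.prems]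
    unfolding Ck_Suc_iff by (auto intro!: continuous_intros)
qed (auto intro: continuous_intros)

lemma Ck_mult [intro]: "Ck k u \<Longrightarrow> Ck k w \<Longrightarrow> Ck k (\<lambda>x. u x * w x)"
proof (induction k arbitrary: u w)
  case (Suc k)
  have "\<exists>d. ((\<lambda>t. u (x + t *\<^sub>R axis i 1) * w (x + t *\<^sub>R axis i 1)) has_real_derivative d) (at 0)" for x i
    using DERIV_mult[OF has_partial0[OF Suc.prems(1)] has_partial0[OF Suc.prems(2)]] by blast
  then show ?case
    using Suc.IH Suc.prems[THEN Ck_partial] Suc.prems[THEN Ck_Suc_D] Suc.prems[THEN Ck_continuous]
      partial_mult[OF Suc.prems]
    unfolding Ck_Suc_iff by (auto intro!: continuous_intros Ck_add)
qed (auto intro: continuous_intros)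

lemma Ck_diff [intro]: "Ck k u \<Longrightarrow> Ck k w \<Longrightarrow> Ck k (\<lambda>x. u x - w x)"
  using Ck_add[OF _ Ck_mult[OF Ck_const[of k "-1"]], of u w] by simp

lemma Ck_sum [intro]: "(\<And>j. j \<in> A \<Longrightarrow> Ck k (u j)) \<Longrightarrow> Ck k (\<lambda>x. \<Sum>j\<in>A. u j x)"
  by (induction A rule: infinite_finite_induct) auto

lemma Ck_power [intro]: "Ck k u \<Longrightarrow> Ck k (\<lambda>x. u x ^ m)"
  by (induction m) auto

text \<open>The exponent is generalised in the induction, since differentiating lowers it.\<close>

lemma Ck_powr: "Ck k u \<Longrightarrow> (\<And>x. u x > 0) \<Longrightarrow> Ck k (\<lambda>x. u x powr a)"
proof (induction k arbitrary: a)
  case (Suc k)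
  have "\<exists>d. ((\<lambda>t. u (x + t *\<^sub>R axis i 1) powr a) has_real_derivative d) (at 0)" for x i
    using DERIV_fun_powr[OF has_partial0[OF Suc.prems(1)], of x] Suc.prems(2) by fastforce
  moreover have "continuous_on UNIV (\<lambda>x. u x powr a)"
    using Ck_continuous[OF Suc.prems(1)] Suc.prems(2)
    by (intro continuous_intros) (auto simp: less_imp_neq[symmetric])
  moreover have "Ck k (partial i (\<lambda>x. u x powr a))" for i
    unfolding partial_powr[OF Suc.prems]
    using Suc.IH[of "a - 1"] Suc.prems Ck_Suc_D[OF Suc.prems(1)] Ck_partial[OF Suc.prems(1)]
    by (intro Ck_mult Ck_const) auto
  ultimately show ?case
    unfolding Ck_Suc_iff by blast
next
  case 0
  then show ?case
    by (auto intro!: continuous_intros simp: less_imp_neq[symmetric])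
qed

subsection \<open>Symmetry of second derivatives\<close>

text \<open>Mean value theorem in direction i, then in direction j. The left-hand side does not change when
  i and j are exchanged, which is why second derivatives commute.\<close>

lemma second_difference:
  fixes u :: "real ^ 'n \<Rightarrow> real"
  assumes u: "Ck (Suc (Suc k)) u" and s: "s > 0"
  obtains a b where "0 < a" "a < s" "0 < b" "b < s"
    "u (x + s *\<^sub>R axis i 1 + s *\<^sub>R axis j 1) - u (x + s *\<^sub>R axis i 1) - u (x + s *\<^sub>R axis j 1) + u x
       = s * s * partial j (partial i u) (x + a *\<^sub>R axis i 1 + b *\<^sub>R axis j 1)"
proof -
  have u1: "Ck (Suc k) u" using u by (rule Ck_Suc_D)
  let ?p = "\<lambda>t. u (x + s *\<^sub>R axis j 1 + t *\<^sub>R axis i 1) - u (x + t *\<^sub>R axis i 1)"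
  have "\<And>t. (?p has_real_derivative (partial i u (x + s *\<^sub>R axis j 1 + t *\<^sub>R axis i 1)
      - partial i u (x + t *\<^sub>R axis i 1))) (at t)"
    by (intro DERIV_diff has_partial[OF u1])
  then obtain a where a: "0 < a" "a < s" and
    1: "?p s - ?p 0 = (s - 0) * (partial i u (x + s *\<^sub>R axis j 1 + a *\<^sub>R axis i 1)
      - partial i u (x + a *\<^sub>R axis i 1))"
    using MVT2[OF s, of ?p "\<lambda>t. partial i u (x + s *\<^sub>R axis j 1 + t *\<^sub>R axis i 1)
      - partial i u (x + t *\<^sub>R axis i 1)"] by blast
  have "\<And>t. ((\<lambda>t. partial i u ((x + a *\<^sub>R axis i 1) + t *\<^sub>R axis j 1)) has_real_derivative
      partial j (partial i u) ((x + a *\<^sub>R axis i 1) + t *\<^sub>R axis j 1)) (at t)"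
    by (intro has_partial[OF Ck_partial[OF u]])
  then obtain b where b: "0 < b" "b < s" and
    2: "partial i u ((x + a *\<^sub>R axis i 1) + s *\<^sub>R axis j 1) - partial i u ((x + a *\<^sub>R axis i 1) + 0 *\<^sub>R axis j 1)
      = (s - 0) * partial j (partial i u) ((x + a *\<^sub>R axis i 1) + b *\<^sub>R axis j 1)"
    using MVT2[OF s, of "\<lambda>t. partial i u ((x + a *\<^sub>R axis i 1) + t *\<^sub>R axis j 1)"
      "\<lambda>t. partial j (partial i u) ((x + a *\<^sub>R axis i 1) + t *\<^sub>R axis j 1)"] by blast
  have "x + s *\<^sub>R axis j 1 + a *\<^sub>R axis i 1 = x + a *\<^sub>R axis i 1 + s *\<^sub>R axis j (1::real)"
    "x + s *\<^sub>R axis j 1 + s *\<^sub>R axis i 1 = x + s *\<^sub>R axis i 1 + s *\<^sub>R axis j (1::real)"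
    by (simp_all add: algebra_simps)
  with 1 2 have "u (x + s *\<^sub>R axis i 1 + s *\<^sub>R axis j 1) - u (x + s *\<^sub>R axis i 1) - u (x + s *\<^sub>R axis j 1) + u x
       = s * s * partial j (partial i u) (x + a *\<^sub>R axis i 1 + b *\<^sub>R axis j 1)"
    by (simp add: algebra_simps)
  with a b show ?thesis by (rule that)
qed

lemma partial_commute:
  fixes u :: "real ^ 'n \<Rightarrow> real"
  assumes u: "Ck (Suc (Suc k)) u"
  shows "partial j (partial i u) = partial i (partial j u)"
proof (rule ext, rule ccontr)
  fix x
  let ?U = "partial j (partial i u)" and ?W = "partial i (partial j u)"
  assume neq: "?U x \<noteq> ?W x"
  define e where "e = dist (?U x) (?W x) / 2"
  have e: "e > 0" using neq by (simp add: e_def)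
  have "isCont ?U x" "isCont ?W x"
    using u Ck_continuous[OF Ck_partial[OF Ck_partial[OF u]]] by (auto simp: continuous_on_eq_continuous_at)
  then obtain d1 d2 where d: "d1 > 0" "d2 > 0"
    "\<And>y. dist y x < d1 \<Longrightarrow> dist (?U y) (?U x) < e" "\<And>y. dist y x < d2 \<Longrightarrow> dist (?W y) (?W x) < e"
    using e unfolding continuous_at_eps_delta by (metis dist_commute)
  define s where "s = min d1 d2 / 2"
  have s: "s > 0" "2 * s \<le> d1" "2 * s \<le> d2" using d by (auto simp: s_def)
  have close: "dist (x + a *\<^sub>R axis i' 1 + b *\<^sub>R axis j' 1) x < 2 * s"
    if "0 < a" "a < s" "0 < b" "b < s" for a b i' j'
  proof -
    have "norm (a *\<^sub>R axis i' 1 + b *\<^sub>R axis j' 1 :: real ^ 'n) \<le> a + b"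
      using norm_triangle_ineq[of "a *\<^sub>R axis i' (1::real)" "b *\<^sub>R axis j' 1"] that
      by simp
    then show ?thesis using that by (simp add: dist_norm add.assoc)
  qed
  obtain a b where ab: "0 < a" "a < s" "0 < b" "b < s"
    "u (x + s *\<^sub>R axis i 1 + s *\<^sub>R axis j 1) - u (x + s *\<^sub>R axis i 1) - u (x + s *\<^sub>R axis j 1) + u x
       = s * s * ?U (x + a *\<^sub>R axis i 1 + b *\<^sub>R axis j 1)"
    by (rule second_difference[OF u s(1)])
  obtain a' b' where ab': "0 < a'" "a' < s" "0 < b'" "b' < s"
    "u (x + s *\<^sub>R axis j 1 + s *\<^sub>R axis i 1) - u (x + s *\<^sub>R axis j 1) - u (x + s *\<^sub>R axis i 1) + u x
       = s * s * ?W (x + a' *\<^sub>R axis j 1 + b' *\<^sub>R axis i 1)"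
    by (rule second_difference[OF u s(1)])
  have "x + s *\<^sub>R axis j 1 + s *\<^sub>R axis i 1 = x + s *\<^sub>R axis i 1 + s *\<^sub>R axis j (1::real)"
    by (simp add: algebra_simps)
  then have "s * s * ?U (x + a *\<^sub>R axis i 1 + b *\<^sub>R axis j 1) = s * s * ?W (x + a' *\<^sub>R axis j 1 + b' *\<^sub>R axis i 1)"
    using ab(5) ab'(5) by (simp add: algebra_simps)
  then have eq: "?U (x + a *\<^sub>R axis i 1 + b *\<^sub>R axis j 1) = ?W (x + a' *\<^sub>R axis j 1 + b' *\<^sub>R axis i 1)"
    using s by simp
  have "dist (?U (x + a *\<^sub>R axis i 1 + b *\<^sub>R axis j 1)) (?U x) < e"
    using close[OF ab(1-4), of i j] s by (intro d) auto
  moreover have "dist (?W (x + a' *\<^sub>R axis j 1 + b' *\<^sub>R axis i 1)) (?W x) < e"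
    using close[OF ab'(1-4), of j i] s by (intro d) auto
  ultimately have "dist (?U x) (?W x) < e + e"
    unfolding eq dist_real_def by linarith
  then show False by (simp add: e_def)
qed

(* Membership in Ck is from here on derived from the rules above, never by unfolding. *)
declare Ck_on.simps [simp del]

section \<open>Second-order operators\<close>

lemma second_derivative_line:
  fixes u :: "real ^ 'n \<Rightarrow> real"
  assumes u: "Ck (Suc (Suc k)) u"
  shows "((\<lambda>t. \<Sum>i\<in>UNIV. d $ i * partial i u (x + t *\<^sub>R d)) has_real_derivative
           (\<Sum>i\<in>UNIV. \<Sum>j\<in>UNIV. d $ i * d $ j * partial j (partial i u) (x + t *\<^sub>R d))) (at t)"
proof -
  have "((\<lambda>t. \<Sum>i\<in>UNIV. d $ i * partial i u (x + t *\<^sub>R d)) has_real_derivative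
     (\<Sum>i\<in>UNIV. d $ i * (\<Sum>j\<in>UNIV. d $ j * partial j (partial i u) (x + t *\<^sub>R d)))) (at t)"
    by (intro DERIV_sum DERIV_cmult has_derivative_line[OF Ck_partial[OF u]])
  then show ?thesis by (simp add: sum_distrib_left mult_ac)
qed

text \<open>A maximum of u is one of its restriction to each line; were the second derivative of the
  restriction positive, its first derivative would be positive, and u increasing, just after the
  maximum.\<close>

lemma local_max_line:
  fixes u :: "real ^ 'n \<Rightarrow> real"
  assumes u: "Ck (Suc (Suc k)) u" and max: "\<forall>\<^sub>F y in nhds x. u y \<le> u x"
  shows "(\<Sum>i\<in>UNIV. d $ i * partial i u x) = 0"
    and "(\<Sum>i\<in>UNIV. \<Sum>j\<in>UNIV. d $ i * d $ j * partial j (partial i u) x) \<le> 0"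
proof -
  let ?p = "\<lambda>t. u (x + t *\<^sub>R d)"
  let ?p' = "\<lambda>t. \<Sum>i\<in>UNIV. d $ i * partial i u (x + t *\<^sub>R d)"
  let ?p'' = "\<Sum>i\<in>UNIV. \<Sum>j\<in>UNIV. d $ i * d $ j * partial j (partial i u) x"
  have "((\<lambda>t. x + t *\<^sub>R d) \<longlongrightarrow> x + 0 *\<^sub>R d) (nhds 0)"
    by (intro tendsto_intros filterlim_ident)
  then have "\<forall>\<^sub>F t in nhds 0. ?p t \<le> ?p 0"
    using eventually_compose_filterlim[OF max, of "\<lambda>t. x + t *\<^sub>R d" "nhds 0"] by simp
  then obtain e where e: "e > 0" "\<And>t. \<bar>t\<bar> < e \<Longrightarrow> ?p t \<le> ?p 0"
    by (auto simp: eventually_nhds_metric dist_real_def)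
  have p: "(?p has_real_derivative ?p' t) (at t)" for t
    by (rule has_derivative_line[OF Ck_Suc_D[OF u]])
  have 0: "?p' 0 = 0"
    by (rule DERIV_local_max[OF p e(1)]) (use e(2) in auto)
  then show "(\<Sum>i\<in>UNIV. d $ i * partial i u x) = 0" by simp
  show "?p'' \<le> 0"
  proof (rule ccontr)
    assume "\<not> ?p'' \<le> 0"
    moreover have "(?p' has_real_derivative ?p'') (at 0)"
      using second_derivative_line[OF u, of d x 0] by simp
    ultimately have "\<exists>e'>0. \<forall>h>0. h < e' \<longrightarrow> ?p' 0 < ?p' (0 + h)"
      by (intro DERIV_pos_inc_right) (simp_all only: not_le)
    then obtain e' where e': "e' > 0" "\<And>h. 0 < h \<Longrightarrow> h < e' \<Longrightarrow> ?p' 0 < ?p' (0 + h)"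
      by blast
    define s where "s = min e e' / 2"
    have s: "0 < s" "s < e" "s < e'" using e(1) e'(1) by (auto simp: s_def)
    obtain z where z: "0 < z" "z < s" "?p s - ?p 0 = (s - 0) * ?p' z"
      using MVT2[OF s(1), of ?p ?p'] p by blast
    have "?p' z > 0" using e'(2)[of z] z s 0 by simp
    then have "?p s - ?p 0 > 0" using z(3) s(1) by simp
    then show False using e(2)[of s] s by simp
  qed
qed

text \<open>For n = p / sqrt (1 - |p|^2) this is the inverse of the matrix with entries \<delta>_kl - p_k p_l,
  the metric induced on a spacelike graph with gradient p.\<close>

definition ginv :: "('n \<Rightarrow> real) \<Rightarrow> 'n \<Rightarrow> 'n \<Rightarrow> real" where
  "ginv n k l = (if k = l then 1 else 0) + n k * n l"

definition gdot :: "('n::finite \<Rightarrow> real) \<Rightarrow> ('n \<Rightarrow> real) \<Rightarrow> ('n \<Rightarrow> real) \<Rightarrow> real" where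
  "gdot n a b = (\<Sum>k\<in>UNIV. \<Sum>l\<in>UNIV. ginv n k l * a k * b l)"

lemma ginv_sym: "ginv n k l = ginv n l k"
  by (auto simp: ginv_def)

lemma sum_ginv:
  fixes a :: "'n::finite \<Rightarrow> real"
  shows "(\<Sum>l\<in>UNIV. ginv n k l * a l) = a k + n k * (\<Sum>l\<in>UNIV. n l * a l)"
  by (simp add: ginv_def distrib_right sum.distrib sum_distrib_left mult.assoc if_distrib[of "\<lambda>x. x * _"] cong: if_cong)

lemma gdot_eq: "gdot n a b = (\<Sum>k\<in>UNIV. a k * b k) + (\<Sum>k\<in>UNIV. n k * a k) * (\<Sum>k\<in>UNIV. n k * b k)"
proof -
  have "gdot n a b = (\<Sum>k\<in>UNIV. a k * (\<Sum>l\<in>UNIV. ginv n k l * b l))"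
    by (simp add: gdot_def sum_distrib_left mult_ac)
  also have "\<dots> = (\<Sum>k\<in>UNIV. a k * b k + (n k * a k) * (\<Sum>l\<in>UNIV. n l * b l))"
    unfolding sum_ginv by (simp add: algebra_simps)
  also have "\<dots> = (\<Sum>k\<in>UNIV. a k * b k) + (\<Sum>k\<in>UNIV. n k * a k) * (\<Sum>k\<in>UNIV. n k * b k)"
    by (simp only: sum.distrib sum_distrib_right)
  finally show ?thesis .
qed

lemma gdot_sym: "gdot n a b = gdot n b a"
  by (simp add: gdot_eq mult_ac)

lemma gdot_add: "gdot n (\<lambda>k. a k + b k) c = gdot n a c + gdot n b c"
  by (simp add: gdot_def algebra_simps sum.distrib)

lemma gdot_scale: "gdot n (\<lambda>k. c * a k) b = c * gdot n a b"
  by (simp add: gdot_def algebra_simps sum_distrib_left)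

lemma gdot_scale_right: "gdot n a (\<lambda>k. c * b k) = c * gdot n a b"
  by (simp add: gdot_def algebra_simps sum_distrib_left)

text \<open>For N = Df / sqrt (1 - |Df|^2) the second-order part of the Laplace-Beltrami operator of the graph
  of f, and on a maximal graph the whole operator. The function gam is then the product of
  gradients.\<close>

definition lap :: "('n \<Rightarrow> real ^ 'n \<Rightarrow> real) \<Rightarrow> (real ^ 'n \<Rightarrow> real) \<Rightarrow> real ^ 'n \<Rightarrow> real" where
  "lap N u x = (\<Sum>k\<in>UNIV. \<Sum>l\<in>UNIV. ginv (\<lambda>i. N i x) k l * partial l (partial k u) x)"

definition gam :: "('n \<Rightarrow> real ^ 'n \<Rightarrow> real) \<Rightarrow> (real ^ 'n \<Rightarrow> real) \<Rightarrow> (real ^ 'n \<Rightarrow> real) \<Rightarrow> real ^ 'n \<Rightarrow> real" where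
  "gam N u w x = gdot (\<lambda>i. N i x) (\<lambda>k. partial k u x) (\<lambda>k. partial k w x)"

lemma gam_sym: "gam N u w x = gam N w u x"
  unfolding gam_def by (rule gdot_sym)

lemma lap_eq: "lap N u x = (\<Sum>k\<in>UNIV. partial k (partial k u) x)
   + (\<Sum>k\<in>UNIV. \<Sum>l\<in>UNIV. N k x * N l x * partial l (partial k u) x)"
  by (simp add: lap_def ginv_def distrib_right sum.distrib if_distrib[of "\<lambda>x. x * _"] cong: if_cong)

text \<open>As ginv is the identity plus the square of one vector, lap is a sum of second derivatives along
  lines: those parallel to the axes and the one in direction N.\<close>

lemma lap_local_max:
  fixes u :: "real ^ 'n \<Rightarrow> real"
  assumes u: "Ck (Suc (Suc k)) u" and max: "\<forall>\<^sub>F y in nhds x. u y \<le> u x"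
  shows "lap N u x \<le> 0" and "partial i u x = 0"
proof -
  have ax: "(\<Sum>j\<in>UNIV. axis i 1 $ j * a j) = a i" for a :: "'n \<Rightarrow> real" and i
    by (simp add: axis_def if_distrib[of "\<lambda>x. x * _"] cong: if_cong)
  show "partial i u x = 0"
    using local_max_line(1)[OF u max, of "axis i 1"] by (simp add: ax)
  have "partial i (partial i u) x \<le> 0" for i
    using local_max_line(2)[OF u max, of "axis i 1"]
    by (simp add: mult.assoc ax flip: sum_distrib_left)
  then have "(\<Sum>k\<in>UNIV. partial k (partial k u) x) \<le> 0"
    by (intro sum_nonpos) auto
  then show "lap N u x \<le> 0"
    using local_max_line(2)[OF u max, of "\<chi> i. N i x"] by (simp add: lap_eq)
qed

lemma lap_add:
  assumes "Ck (Suc (Suc k)) u" "Ck (Suc (Suc m)) w"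
  shows "lap N (\<lambda>x. u x + w x) x = lap N u x + lap N w x"
  by (simp add: lap_def partial_add[OF assms] partial_add[OF assms[THEN Ck_Suc_D]]
      partial_add[OF assms[THEN Ck_partial]] algebra_simps sum.distrib)

lemma lap_diff:
  assumes "Ck (Suc (Suc k)) u" "Ck (Suc (Suc m)) w"
  shows "lap N (\<lambda>x. u x - w x) x = lap N u x - lap N w x"
  by (simp add: lap_def partial_diff[OF assms] partial_diff[OF assms[THEN Ck_Suc_D]]
      partial_diff[OF assms[THEN Ck_partial]] algebra_simps sum_subtractf)

lemma lap_const [simp]: "lap N (\<lambda>x. c) x = 0"
  by (simp add: lap_def)

lemma lap_coord [simp]: "lap N (\<lambda>x. x $ j) x = 0"
  by (simp add: lap_def partial_coord)

lemma lap_sum: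
  assumes "\<And>j. Ck (Suc (Suc k)) (u j)"
  shows "lap N (\<lambda>x. \<Sum>j\<in>A. u j x) x = (\<Sum>j\<in>A. lap N (u j) x)"
  by (induction A rule: infinite_finite_induct) (auto simp: lap_add[OF assms Ck_sum[OF assms]])

lemma lap_mult:
  assumes u: "Ck (Suc (Suc k)) u" and w: "Ck (Suc (Suc m)) w"
  shows "lap N (\<lambda>x. u x * w x) x = u x * lap N w x + w x * lap N u x + 2 * gam N u w x"
proof -
  let ?g = "ginv (\<lambda>i. N i x)"
  have "partial l (partial k (\<lambda>x. u x * w x)) x = u x * partial l (partial k w) x + w x * partial l (partial k u) x
     + partial k u x * partial l w x + partial l u x * partial k w x" for k l
    by (simp add: partial_mult[OF Ck_Suc_D[OF u] Ck_Suc_D[OF w]] partial_add[OF Ck_mult[of "Suc 0"] Ck_mult[of "Suc 0"]]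
        Ck_mono[OF u] Ck_mono[OF w] Ck_mono[OF Ck_partial[OF u]] Ck_mono[OF Ck_partial[OF w]]
        partial_mult[OF Ck_partial[OF u] Ck_Suc_D[OF w]] partial_mult[OF Ck_Suc_D[OF u] Ck_partial[OF w]])
  then have "lap N (\<lambda>x. u x * w x) x = (\<Sum>k\<in>UNIV. \<Sum>l\<in>UNIV. u x * (?g k l * partial l (partial k w) x)
       + w x * (?g k l * partial l (partial k u) x) + ?g k l * partial k u x * partial l w x
       + ?g k l * partial k w x * partial l u x)"
    unfolding lap_def by (simp add: algebra_simps)
  also have "\<dots> = u x * lap N w x + w x * lap N u x + gam N u w x + gam N w u x"
    by (simp add: lap_def gam_def gdot_def sum.distrib sum_distrib_left)
  finally show ?thesis by (simp add: gam_sym[of N w u])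
qed

lemma gam_coord: "gam N u (\<lambda>x. x $ j) x = (\<Sum>k\<in>UNIV. ginv (\<lambda>i. N i x) k j * partial k u x)"
  by (simp add: gam_def gdot_def partial_coord if_distrib[of "\<lambda>x. _ * x"] cong: if_cong)

text \<open>The second term comes from the coefficients of lap, which depend on the point through N.\<close>

lemma partial_lap:
  fixes u :: "real ^ 'n \<Rightarrow> real"
  assumes u: "Ck (Suc (Suc (Suc k))) u" and N: "\<And>i. Ck (Suc m) (N i)"
  shows "partial j (lap N u) x = lap N (partial j u) x
    + 2 * (\<Sum>k\<in>UNIV. \<Sum>l\<in>UNIV. partial j (N k) x * N l x * partial l (partial k u) x)"
proof -
  have c: "Ck (Suc 0) (N i)" "Ck (Suc 0) (partial l (partial k u))" for i k l
    using Ck_mono[OF N, of "Suc 0"] Ck_mono[OF Ck_partial[OF Ck_partial[OF u]], of "Suc 0"] by auto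
  have comm: "partial j (partial l (partial k u)) = partial l (partial k (partial j u))" for k l
    by (simp add: partial_commute[OF Ck_partial[OF u], of j l] partial_commute[OF Ck_Suc_D[OF u], of j k])
  have sym: "partial l (partial k u) = partial k (partial l u)" for k l
    by (rule partial_commute[OF Ck_Suc_D[OF u]])
  have "partial j (lap N u) x = (\<Sum>k\<in>UNIV. partial j (partial k (partial k u)) x)
     + (\<Sum>k\<in>UNIV. \<Sum>l\<in>UNIV. (partial j (N k) x * N l x + N k x * partial j (N l) x) * partial l (partial k u) x
         + N k x * N l x * partial j (partial l (partial k u)) x)"
    unfolding lap_eq[abs_def]
    by (simp add: partial_add[of 0 _ 0] partial_sum[of _ 0] partial_mult[of 0 _ 0] c Ck_sum Ck_mult)
  also have "\<dots> = lap N (partial j u) x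
     + (\<Sum>k\<in>UNIV. \<Sum>l\<in>UNIV. partial j (N k) x * N l x * partial l (partial k u) x)
     + (\<Sum>k\<in>UNIV. \<Sum>l\<in>UNIV. partial j (N l) x * N k x * partial l (partial k u) x)"
    by (simp add: lap_eq comm sum.distrib algebra_simps)
  also have "(\<Sum>k\<in>UNIV. \<Sum>l\<in>UNIV. partial j (N l) x * N k x * partial l (partial k u) x)
     = (\<Sum>k\<in>UNIV. \<Sum>l\<in>UNIV. partial j (N k) x * N l x * partial l (partial k u) x)"
    by (subst sum.swap) (simp add: sym)
  finally show ?thesis by simp
qed


section \<open>Self-adjoint operators and symmetric tensors\<close>

lemma sum_rotate:
  "(\<Sum>i\<in>A. \<Sum>m\<in>B. \<Sum>k\<in>C. f i m k) = (\<Sum>k\<in>C. \<Sum>i\<in>A. \<Sum>m\<in>B. f i m k)"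
proof -
  have "(\<Sum>i\<in>A. \<Sum>m\<in>B. \<Sum>k\<in>C. f i m k) = (\<Sum>i\<in>A. \<Sum>k\<in>C. \<Sum>m\<in>B. f i m k)"
    by (intro sum.cong refl sum.swap)
  also have "\<dots> = (\<Sum>k\<in>C. \<Sum>i\<in>A. \<Sum>m\<in>B. f i m k)"
    by (rule sum.swap)
  finally show ?thesis .
qed

text \<open>M = ginv X is the operator belonging to the symmetric form X, and tr M^2 is the squared norm of X.
  It is a sum of squares because ginv is the identity plus the square of n.\<close>

lemma trace_square_ginv:
  fixes n :: "'n::finite \<Rightarrow> real"
  assumes sym: "\<And>j k. X j k = X k j" and M: "\<And>j k. M j k = (\<Sum>l\<in>UNIV. ginv n j l * X l k)"
  shows "(\<Sum>j\<in>UNIV. \<Sum>k\<in>UNIV. M j k * M k j) = (\<Sum>j\<in>UNIV. \<Sum>k\<in>UNIV. (X j k)\<^sup>2)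
     + 2 * (\<Sum>k\<in>UNIV. (\<Sum>l\<in>UNIV. n l * X l k)\<^sup>2) + (\<Sum>k\<in>UNIV. n k * (\<Sum>l\<in>UNIV. n l * X l k))\<^sup>2"
proof -
  define a where "a k = (\<Sum>l\<in>UNIV. n l * X l k)" for k
  have M': "M j k = X j k + n j * a k" for j k
    by (simp add: M sum_ginv a_def)
  have a1: "(\<Sum>k\<in>UNIV. X j k * n k) = a j" for j
    unfolding a_def by (intro sum.cong) (auto simp: sym[of j])
  have "(\<Sum>j\<in>UNIV. \<Sum>k\<in>UNIV. M j k * M k j)
      = (\<Sum>j\<in>UNIV. \<Sum>k\<in>UNIV. (X j k)\<^sup>2 + a j * (X j k * n k) + a k * (n j * X j k) + (n j * a j) * (n k * a k))"
    by (intro sum.cong refl) (auto simp: M' sym[of _ j for j] power2_eq_square algebra_simps)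
  also have "\<dots> = (\<Sum>j\<in>UNIV. \<Sum>k\<in>UNIV. (X j k)\<^sup>2) + (\<Sum>j\<in>UNIV. a j * (\<Sum>k\<in>UNIV. X j k * n k))
      + (\<Sum>j\<in>UNIV. \<Sum>k\<in>UNIV. a k * (n j * X j k)) + (\<Sum>j\<in>UNIV. n j * a j) * (\<Sum>k\<in>UNIV. n k * a k)"
    unfolding sum_product by (simp add: sum.distrib sum_distrib_left)
  also have "(\<Sum>j\<in>UNIV. \<Sum>k\<in>UNIV. a k * (n j * X j k)) = (\<Sum>k\<in>UNIV. a k * (\<Sum>j\<in>UNIV. n j * X j k))"
    by (subst sum.swap) (simp add: sum_distrib_left)
  finally show ?thesis
    by (simp add: a1 flip: a_def) (simp add: power2_eq_square)
qed

lemma trace_square_ginv_nonneg: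
  fixes n :: "'n::finite \<Rightarrow> real"
  assumes sym: "\<And>j k. X j k = X k j" and M: "\<And>j k. M j k = (\<Sum>l\<in>UNIV. ginv n j l * X l k)"
  shows "(\<Sum>j\<in>UNIV. \<Sum>k\<in>UNIV. M j k * M k j) \<ge> 0"
  unfolding trace_square_ginv[OF sym M] by (intro add_nonneg_nonneg mult_nonneg_nonneg sum_nonneg) auto

lemma trace_square_ginv_eq_0D:
  fixes n :: "'n::finite \<Rightarrow> real"
  assumes sym: "\<And>j k. X j k = X k j" and M: "\<And>j k. M j k = (\<Sum>l\<in>UNIV. ginv n j l * X l k)"
    and 0: "(\<Sum>j\<in>UNIV. \<Sum>k\<in>UNIV. M j k * M k j) = 0"
  shows "X j k = 0"
proof -
  have "(\<Sum>k\<in>UNIV. (\<Sum>l\<in>UNIV. n l * X l k)\<^sup>2) \<ge> 0" "(\<Sum>k\<in>UNIV. n k * (\<Sum>l\<in>UNIV. n l * X l k))\<^sup>2 \<ge> 0"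
    "(\<Sum>j\<in>UNIV. \<Sum>k\<in>UNIV. (X j k)\<^sup>2) \<ge> 0"
    by (auto intro!: sum_nonneg)
  then have "(\<Sum>j\<in>UNIV. \<Sum>k\<in>UNIV. (X j k)\<^sup>2) = 0"
    using 0 unfolding trace_square_ginv[OF sym M] by linarith
  then show ?thesis
    by (simp add: sum_nonneg_eq_0_iff sum_nonneg)
qed

text \<open>A self-adjoint operator S with eigenvalue \<mu> and trace zero has other eigenvalues with sum -\<mu>,
  so tr S^2 exceeds \<mu>^2 by at least \<mu>^2 / (m - 1), m being the dimension. To avoid
  diagonalisation, S is compared with K = m P - 1, where P is the projection to the eigenvector:
  S - c K is again self-adjoint, so its square has non-negative trace, and c = \<mu> / (m - 1) is the
  best choice. As S acts here on the left index, y is an eigenvector of the transpose.\<close>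

lemma eigenvalue_le_trace_square:
  fixes n p y :: "'n::finite \<Rightarrow> real"
  assumes sym: "\<And>j k. h j k = h k j" and S: "\<And>j k. S j k = (\<Sum>l\<in>UNIV. ginv n j l * h l k)"
    and n: "\<And>k. n k = v * p k" and v: "v\<^sup>2 = 1 + (\<Sum>k\<in>UNIV. (n k)\<^sup>2)"
    and trace: "(\<Sum>j\<in>UNIV. S j j) = 0"
    and eigen: "\<And>k. (\<Sum>j\<in>UNIV. S j k * y j) = \<mu> * y k" and y: "gdot n y y \<noteq> 0"
    and card: "CARD('n) \<ge> 2"
  shows "real CARD('n) * \<mu>\<^sup>2 \<le> (real CARD('n) - 1) * (\<Sum>j\<in>UNIV. \<Sum>k\<in>UNIV. S j k * S k j)"
proof -
  define d where "d = gdot n y y"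
  define m where "m = real CARD('n)"
  have m: "m \<ge> 2" using card by (simp add: m_def)
  \<comment> \<open>the metric itself, so that the identity operator in K comes from a symmetric form\<close>
  define g where "g l j = (if l = j then 1 else 0) - p l * p j" for l j
  define z where "z j = (\<Sum>l\<in>UNIV. ginv n j l * y l)" for j
  have vp: "v * (\<Sum>l\<in>UNIV. n l * p l) = v\<^sup>2 - 1"
  proof -
    have "v * (\<Sum>l\<in>UNIV. n l * p l) = (\<Sum>l\<in>UNIV. (n l)\<^sup>2)"
      by (simp add: n power2_eq_square sum_distrib_left mult_ac)
    then show ?thesis using v by simp
  qed
  have inv: "(\<Sum>l\<in>UNIV. ginv n k l * g l j) = (if k = j then 1 else 0)" for k j
  proof -
    have "(\<Sum>l\<in>UNIV. ginv n k l * g l j) = g k j + n k * (\<Sum>l\<in>UNIV. n l * g l j)"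
      by (rule sum_ginv)
    also have "(\<Sum>l\<in>UNIV. n l * g l j) = n j - (\<Sum>l\<in>UNIV. n l * p l) * p j"
      by (simp add: g_def algebra_simps sum_subtractf sum_distrib_left if_distrib[of "\<lambda>x. _ * x"] cong: if_cong)
    also have "g k j + n k * (n j - (\<Sum>l\<in>UNIV. n l * p l) * p j) =
      (if k = j then 1 else 0) + p k * p j * (v\<^sup>2 - 1 - v * (\<Sum>l\<in>UNIV. n l * p l))"
      by (simp add: g_def n power2_eq_square algebra_simps)
    finally show ?thesis by (simp add: vp)
  qed
  have zy: "(\<Sum>j\<in>UNIV. z j * y j) = d"
    by (simp add: z_def d_def gdot_def sum_distrib_left sum_distrib_right mult_ac)
  define K where "K j k = m / d * z j * y k - (if j = k then 1 else 0)" for j k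
  have dne: "d \<noteq> 0" using y by (simp add: d_def)
  have SK: "(\<Sum>j\<in>UNIV. \<Sum>k\<in>UNIV. S j k * K k j) = m * \<mu>"
  proof -
    have "(\<Sum>j\<in>UNIV. \<Sum>k\<in>UNIV. S j k * K k j)
        = (\<Sum>j\<in>UNIV. \<Sum>k\<in>UNIV. m / d * z k * (S j k * y j)) - (\<Sum>j\<in>UNIV. S j j)"
      by (simp add: K_def algebra_simps sum_subtractf if_distrib[of "\<lambda>x. _ * x"] cong: if_cong)
    also have "(\<Sum>j\<in>UNIV. \<Sum>k\<in>UNIV. m / d * z k * (S j k * y j)) = (\<Sum>k\<in>UNIV. m / d * z k * (\<mu> * y k))"
      by (subst sum.swap) (simp only: eigen flip: sum_distrib_left)
    also have "\<dots> = m / d * \<mu> * (\<Sum>k\<in>UNIV. z k * y k)"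
      by (simp only: sum_distrib_left mult_ac)
    finally show ?thesis using dne by (simp add: trace zy)
  qed
  have KK: "(\<Sum>j\<in>UNIV. \<Sum>k\<in>UNIV. K j k * K k j) = m * (m - 1)"
  proof -
    have "(\<Sum>j\<in>UNIV. \<Sum>k\<in>UNIV. K j k * K k j) =
      (\<Sum>j\<in>UNIV. \<Sum>k\<in>UNIV. (m / d)\<^sup>2 * ((z j * y j) * (z k * y k)) - (if j = k then 2 * (m / d) * (z j * y j) - 1 else 0))"
      by (intro sum.cong refl) (auto simp: K_def power2_eq_square algebra_simps)
    also have "\<dots> = (m / d)\<^sup>2 * ((\<Sum>j\<in>UNIV. z j * y j) * (\<Sum>k\<in>UNIV. z k * y k)) - (2 * (m / d) * (\<Sum>j\<in>UNIV. z j * y j) - m)"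
      unfolding sum_product by (simp add: sum_subtractf sum_distrib_left m_def)
    also have "\<dots> = m * (m - 1)"
      using dne unfolding zy by (simp add: field_simps power2_eq_square)
    finally show ?thesis .
  qed
  define c where "c = \<mu> / (m - 1)"
  define X where "X l k = h l k - c * (m / d * y l * y k - g l k)" for l k
  define M where "M j k = S j k - c * K j k" for j k
  have "(\<Sum>j\<in>UNIV. \<Sum>k\<in>UNIV. M j k * M k j) \<ge> 0"
  proof (rule trace_square_ginv_nonneg)
    show "X j k = X k j" for j k by (simp add: X_def g_def sym[of j k] mult_ac)
    fix j k
    have "(\<Sum>l\<in>UNIV. ginv n j l * X l k)
       = (\<Sum>l\<in>UNIV. ginv n j l * h l k) - c * (m / d * y k * (\<Sum>l\<in>UNIV. ginv n j l * y l) - (\<Sum>l\<in>UNIV. ginv n j l * g l k))"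
      by (simp add: X_def algebra_simps sum_subtractf sum.distrib sum_distrib_left)
    then show "M j k = (\<Sum>l\<in>UNIV. ginv n j l * X l k)"
      unfolding inv S[symmetric] z_def[symmetric] by (simp add: M_def K_def mult_ac)
  qed
  also have "(\<Sum>j\<in>UNIV. \<Sum>k\<in>UNIV. M j k * M k j) = (\<Sum>j\<in>UNIV. \<Sum>k\<in>UNIV. S j k * S k j)
      - c * (\<Sum>j\<in>UNIV. \<Sum>k\<in>UNIV. S j k * K k j) - c * (\<Sum>j\<in>UNIV. \<Sum>k\<in>UNIV. S k j * K j k)
      + c\<^sup>2 * (\<Sum>j\<in>UNIV. \<Sum>k\<in>UNIV. K j k * K k j)"
    by (simp add: M_def algebra_simps power2_eq_square sum_subtractf sum.distrib sum_distrib_left)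
  also have "(\<Sum>j\<in>UNIV. \<Sum>k\<in>UNIV. S k j * K j k) = m * \<mu>"
    by (subst sum.swap) (rule SK)
  finally have "0 \<le> (\<Sum>j\<in>UNIV. \<Sum>k\<in>UNIV. S j k * S k j) - 2 * c * m * \<mu> + c\<^sup>2 * (m * (m - 1))"
    unfolding SK KK by (simp add: algebra_simps)
  also have "c\<^sup>2 * (m * (m - 1)) - 2 * c * m * \<mu> = - (m * \<mu>\<^sup>2 / (m - 1))"
  proof -
    have mu: "\<mu> = c * (m - 1)" using m by (simp add: c_def)
    have "m * \<mu>\<^sup>2 / (m - 1) = m * c\<^sup>2 * (m - 1)"
      using m by (simp add: mu power2_eq_square)
    then show ?thesis by (simp add: mu power2_eq_square algebra_simps)
  qed
  then have "(\<Sum>j\<in>UNIV. \<Sum>k\<in>UNIV. S j k * S k j) - 2 * c * m * \<mu> + c\<^sup>2 * (m * (m - 1))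
     = (\<Sum>j\<in>UNIV. \<Sum>k\<in>UNIV. S j k * S k j) - m * \<mu>\<^sup>2 / (m - 1)" by simp
  finally show ?thesis using m by (simp add: m_def[symmetric] field_simps)
qed

text \<open>The squared norm of a tensor with three indices. The contraction over the last index is the
  ordinary one plus one with n, and for both of them the first two indices are dealt with by
  trace_square_ginv_nonneg.\<close>

lemma gdot_trace_square_nonneg:
  fixes n :: "'n::finite \<Rightarrow> real"
  assumes sym: "\<And>i m k. t i m k = t m i k" and T: "\<And>i m k. T i m k = (\<Sum>p\<in>UNIV. ginv n i p * t p m k)"
  shows "(\<Sum>i\<in>UNIV. \<Sum>m\<in>UNIV. gdot n (T i m) (T m i)) \<ge> 0"
proof -
  have "(\<Sum>i\<in>UNIV. \<Sum>m\<in>UNIV. \<Sum>k\<in>UNIV. T i m k * T m i k) = (\<Sum>k\<in>UNIV. \<Sum>i\<in>UNIV. \<Sum>m\<in>UNIV. T i m k * T m i k)"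
    by (rule sum_rotate)
  also have "\<dots> \<ge> 0"
    by (intro sum_nonneg trace_square_ginv_nonneg[OF sym T])
  finally have 1: "(\<Sum>i\<in>UNIV. \<Sum>m\<in>UNIV. \<Sum>k\<in>UNIV. T i m k * T m i k) \<ge> 0" .
  have 2: "(\<Sum>i\<in>UNIV. \<Sum>m\<in>UNIV. (\<Sum>k\<in>UNIV. n k * T i m k) * (\<Sum>k\<in>UNIV. n k * T m i k)) \<ge> 0"
  proof (rule trace_square_ginv_nonneg)
    show "(\<Sum>k\<in>UNIV. n k * t i m k) = (\<Sum>k\<in>UNIV. n k * t m i k)" for i m
      by (simp add: sym[of i m])
    show "(\<Sum>k\<in>UNIV. n k * T i m k) = (\<Sum>p\<in>UNIV. ginv n i p * (\<Sum>k\<in>UNIV. n k * t p m k))" for i m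
      unfolding T sum_distrib_left by (subst sum.swap) (simp add: mult_ac)
  qed
  show ?thesis using 1 2 by (simp add: gdot_eq sum.distrib)
qed

text \<open>The left-hand side is the squared norm of T = ginv t. In the application S is the shape operator,
  P consists of its partial derivatives, and T = P + Z of its covariant derivatives, Z being made of
  Christoffel symbols. The products of P with Z give the two correction terms, and the squares of Z
  cancel because h S is symmetric.\<close>

lemma simons_algebra:
  fixes n :: "'n::finite \<Rightarrow> real"
  assumes h: "\<And>i j. h i j = h j i" and S: "\<And>i k. S i k = (\<Sum>l\<in>UNIV. ginv n i l * h l k)"
    and b: "\<And>i. b i = (\<Sum>j\<in>UNIV. S i j * n j)"
    and y: "\<And>k m. y k m = (\<Sum>j\<in>UNIV. h k j * S j m)"
    and t: "\<And>i m k. t i m k = t m i k"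
    and P: "\<And>i m k. P i m k = (\<Sum>p\<in>UNIV. ginv n i p * t p m k) + n i * y k m - h k m * b i"
    and Psym: "\<And>i m k. P i m k = P i k m"
  shows "(\<Sum>i\<in>UNIV. \<Sum>m\<in>UNIV. gdot n (P i m) (P m i))
     + 2 * (\<Sum>m\<in>UNIV. b m * (\<Sum>k\<in>UNIV. \<Sum>i\<in>UNIV. S k i * P i k m))
     - 2 * (\<Sum>i\<in>UNIV. \<Sum>k\<in>UNIV. (\<Sum>j\<in>UNIV. S k j * S j i) * (\<Sum>l\<in>UNIV. n l * P i k l)) \<ge> 0"
proof -
  define Z where "Z i m k = h k m * b i - n i * y k m" for i m k
  define Q where "Q k i = (\<Sum>j\<in>UNIV. S k j * S j i)" for k i
  define T where "T i m k = P i m k + Z i m k" for i m k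
  have T': "T i m k = (\<Sum>p\<in>UNIV. ginv n i p * t p m k)" for i m k
    by (simp add: T_def Z_def P)
  have lift: "gdot n a (Z m i) = (\<Sum>k\<in>UNIV. a k * (S k i * b m - n m * Q k i))" for a m i
  proof -
    have "(\<Sum>l\<in>UNIV. ginv n k l * y l i) = Q k i" for k
    proof -
      have "(\<Sum>l\<in>UNIV. ginv n k l * y l i) = (\<Sum>j\<in>UNIV. \<Sum>l\<in>UNIV. ginv n k l * h l j * S j i)"
        unfolding y sum_distrib_left by (subst sum.swap) (simp add: mult_ac)
      then show ?thesis by (simp add: Q_def S[of k] sum_distrib_right)
    qed
    then have "(\<Sum>l\<in>UNIV. ginv n k l * Z m i l) = S k i * b m - n m * Q k i" for k
      by (simp add: Z_def S right_diff_distrib sum_subtractf sum_distrib_right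
          mult.left_commute[of _ "n m"] mult.assoc flip: sum_distrib_left)
    then show ?thesis
      unfolding gdot_def by (simp add: mult.assoc mult.left_commute[of "ginv n k l" for k l] flip: sum_distrib_left)
  qed
  have ysym: "y k m = y m k" for k m
  proof -
    have "y k m = (\<Sum>j\<in>UNIV. \<Sum>l\<in>UNIV. h k j * ginv n j l * h l m)" for k m
      by (simp add: y S sum_distrib_left mult_ac)
    note e = this
    show ?thesis
      unfolding e by (subst sum.swap) (simp add: h[of _ k] h[of m] ginv_sym[of n] mult_ac)
  qed
  define c where "c k = (\<Sum>i\<in>UNIV. S k i * b i)" for k
  define d where "d k = (\<Sum>i\<in>UNIV. h k i * b i)" for k
  have y_mult: "(\<Sum>m\<in>UNIV. y k m * a m) = (\<Sum>j\<in>UNIV. h k j * (\<Sum>m\<in>UNIV. S j m * a m))" for k a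
    unfolding y sum_distrib_left sum_distrib_right by (subst sum.swap) (simp add: mult_ac)
  have Q_mult: "(\<Sum>m\<in>UNIV. Q k m * a m) = (\<Sum>j\<in>UNIV. S k j * (\<Sum>m\<in>UNIV. S j m * a m))" for k a
    unfolding Q_def sum_distrib_left sum_distrib_right by (subst sum.swap) (simp add: mult_ac)
  have hself: "(\<Sum>k\<in>UNIV. a k * (\<Sum>j\<in>UNIV. h k j * c j)) = (\<Sum>j\<in>UNIV. c j * (\<Sum>k\<in>UNIV. h j k * a k))" for a
    unfolding sum_distrib_left by (subst sum.swap) (simp add: h mult_ac)
  have ZZ: "(\<Sum>i\<in>UNIV. \<Sum>m\<in>UNIV. gdot n (Z i m) (Z m i)) = 0"
  proof -
    have "(\<Sum>i\<in>UNIV. \<Sum>m\<in>UNIV. gdot n (Z i m) (Z m i))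
       = (\<Sum>k\<in>UNIV. \<Sum>i\<in>UNIV. \<Sum>m\<in>UNIV. Z i m k * (S k i * b m - n m * Q k i))"
      unfolding lift by (rule sum_rotate)
    also have "\<dots> = (\<Sum>k\<in>UNIV. \<Sum>i\<in>UNIV. \<Sum>m\<in>UNIV. (S k i * b i) * (h k m * b m) - (Q k i * b i) * (h k m * n m)
        - (S k i * n i) * (y k m * b m) + (Q k i * n i) * (y k m * n m))"
      by (simp add: Z_def algebra_simps)
    also have "\<dots> = (\<Sum>k\<in>UNIV. c k * d k - (\<Sum>i\<in>UNIV. Q k i * b i) * (\<Sum>m\<in>UNIV. h k m * n m)
        - (\<Sum>i\<in>UNIV. S k i * n i) * (\<Sum>m\<in>UNIV. y k m * b m)
        + (\<Sum>i\<in>UNIV. Q k i * n i) * (\<Sum>m\<in>UNIV. y k m * n m))"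
      by (simp only: c_def d_def sum.distrib sum_subtractf sum_product)
    also have "\<dots> = (\<Sum>k\<in>UNIV. c k * d k - (\<Sum>i\<in>UNIV. S k i * c i) * (\<Sum>m\<in>UNIV. h k m * n m)
        - b k * (\<Sum>j\<in>UNIV. h k j * c j) + c k * d k)"
      by (simp only: Q_mult y_mult b[symmetric] c_def[symmetric] d_def[symmetric])
    also have "\<dots> = (\<Sum>k\<in>UNIV. c k * d k) - (\<Sum>k\<in>UNIV. (\<Sum>i\<in>UNIV. S k i * c i) * (\<Sum>m\<in>UNIV. h k m * n m))
        - (\<Sum>k\<in>UNIV. b k * (\<Sum>j\<in>UNIV. h k j * c j)) + (\<Sum>k\<in>UNIV. c k * d k)"
      by (simp only: sum.distrib sum_subtractf)
    also have "(\<Sum>k\<in>UNIV. (\<Sum>i\<in>UNIV. S k i * c i) * (\<Sum>m\<in>UNIV. h k m * n m)) = (\<Sum>k\<in>UNIV. c k * d k)"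
    proof -
      have "(\<Sum>k\<in>UNIV. (\<Sum>i\<in>UNIV. S k i * c i) * (\<Sum>m\<in>UNIV. h k m * n m))
          = (\<Sum>i\<in>UNIV. c i * (\<Sum>k\<in>UNIV. S k i * (\<Sum>m\<in>UNIV. h k m * n m)))"
        unfolding sum_distrib_right sum_distrib_left[of "c i" for i] by (subst sum.swap) (simp add: mult_ac)
      moreover have "(\<Sum>k\<in>UNIV. S k i * (\<Sum>m\<in>UNIV. h k m * n m)) = d i" for i
      proof -
        have "(\<Sum>k\<in>UNIV. S k i * (\<Sum>m\<in>UNIV. h k m * n m)) = (\<Sum>m\<in>UNIV. y m i * n m)"
          unfolding y sum_distrib_left sum_distrib_right by (subst sum.swap) (simp add: h mult_ac)
        also have "\<dots> = (\<Sum>m\<in>UNIV. y i m * n m)" by (simp add: ysym[of i])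
        finally show ?thesis unfolding y_mult b[symmetric] d_def .
      qed
      ultimately show ?thesis by simp
    qed
    also have "(\<Sum>k\<in>UNIV. b k * (\<Sum>j\<in>UNIV. h k j * c j)) = (\<Sum>k\<in>UNIV. c k * d k)"
      unfolding hself d_def ..
    finally show ?thesis by simp
  qed
  have PZ: "(\<Sum>i\<in>UNIV. \<Sum>m\<in>UNIV. gdot n (P i m) (Z m i))
     = (\<Sum>m\<in>UNIV. b m * (\<Sum>k\<in>UNIV. \<Sum>i\<in>UNIV. S k i * P i k m))
     - (\<Sum>i\<in>UNIV. \<Sum>k\<in>UNIV. Q k i * (\<Sum>l\<in>UNIV. n l * P i k l))"
  proof -
    have "(\<Sum>i\<in>UNIV. \<Sum>m\<in>UNIV. gdot n (P i m) (Z m i))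
      = (\<Sum>i\<in>UNIV. \<Sum>m\<in>UNIV. \<Sum>k\<in>UNIV. b m * (S k i * P i k m))
        - (\<Sum>i\<in>UNIV. \<Sum>m\<in>UNIV. \<Sum>k\<in>UNIV. Q k i * (n m * P i k m))"
      unfolding lift by (simp add: Psym[of _ m k for m k] right_diff_distrib sum_subtractf mult_ac)
    also have "(\<Sum>i\<in>UNIV. \<Sum>m\<in>UNIV. \<Sum>k\<in>UNIV. b m * (S k i * P i k m))
       = (\<Sum>m\<in>UNIV. b m * (\<Sum>k\<in>UNIV. \<Sum>i\<in>UNIV. S k i * P i k m))"
      unfolding sum_distrib_left by (subst sum.swap) (subst (2) sum.swap, rule refl)
    also have "(\<Sum>i\<in>UNIV. \<Sum>m\<in>UNIV. \<Sum>k\<in>UNIV. Q k i * (n m * P i k m))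
       = (\<Sum>i\<in>UNIV. \<Sum>k\<in>UNIV. Q k i * (\<Sum>l\<in>UNIV. n l * P i k l))"
      unfolding sum_distrib_left by (subst (2) sum.swap) (rule refl)
    finally show ?thesis .
  qed
  have "0 \<le> (\<Sum>i\<in>UNIV. \<Sum>m\<in>UNIV. gdot n (T i m) (T m i))"
    by (rule gdot_trace_square_nonneg[OF t T'])
  also have "gdot n (T i m) (T m i) = gdot n (P i m) (P m i) + gdot n (P i m) (Z m i)
      + gdot n (P m i) (Z i m) + gdot n (Z i m) (Z m i)" for i m
    unfolding T_def[abs_def] gdot_add
    by (subst (1 2) gdot_sym) (simp add: gdot_add gdot_sym[of n "Z m i"] gdot_sym[of n _ "P i m"])
  then have "(\<Sum>i\<in>UNIV. \<Sum>m\<in>UNIV. gdot n (T i m) (T m i))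
     = (\<Sum>i\<in>UNIV. \<Sum>m\<in>UNIV. gdot n (P i m) (P m i)) + (\<Sum>i\<in>UNIV. \<Sum>m\<in>UNIV. gdot n (P i m) (Z m i))
      + (\<Sum>i\<in>UNIV. \<Sum>m\<in>UNIV. gdot n (P m i) (Z i m)) + (\<Sum>i\<in>UNIV. \<Sum>m\<in>UNIV. gdot n (Z i m) (Z m i))"
    by (simp add: sum.distrib)
  also have "(\<Sum>i\<in>UNIV. \<Sum>m\<in>UNIV. gdot n (P m i) (Z i m)) = (\<Sum>i\<in>UNIV. \<Sum>m\<in>UNIV. gdot n (P i m) (Z m i))"
    by (rule sum.swap)
  finally show ?thesis
    unfolding ZZ PZ Q_def by linarith
qed


section \<open>Spacelike maximal graphs\<close>

locale maximal_graph =
  fixes f :: "real ^ 'n \<Rightarrow> real"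
  assumes smooth: "Ck 4 f" and zmc: "\<And>x. A_fun f x = 0" and spacelike: "\<And>x. B_fun f x > 0"
begin

text \<open>The vector (N, v) is the future unit normal of the graph, so v is its Lorentz factor
  B^(-1/2). S = DN is the shape operator in the coordinates of the base, v H the second fundamental
  form, F = tr S^2 = |A|^2, and q abbreviates H p.\<close>

definition "p i = partial i f"
definition "v x = B_fun f x powr (- 1 / 2)"
definition "N i x = v x * p i x"
definition "S i j = partial j (N i)"
definition "H i j = partial j (partial i f)"
definition "q k x = (\<Sum>j\<in>UNIV. p j x * H j k x)"
definition "F x = (\<Sum>i\<in>UNIV. \<Sum>j\<in>UNIV. S i j x * S j i x)"

lemma f_Ck: "Ck (Suc (Suc (Suc (Suc 0)))) f"
  using smooth by (simp add: eval_nat_numeral)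

lemma p_Ck: "Ck (Suc (Suc (Suc 0))) (p i)"
  unfolding p_def by (rule Ck_partial[OF f_Ck])

lemma H_Ck: "Ck (Suc (Suc 0)) (H i j)"
  unfolding H_def by (rule Ck_partial[OF Ck_partial[OF f_Ck]])

lemma B_eq: "B_fun f = (\<lambda>x. 1 - (\<Sum>i\<in>UNIV. (p i x)\<^sup>2))"
  by (simp add: B_fun_def fun_eq_iff p_def)

lemma B_Ck: "Ck (Suc (Suc (Suc 0))) (B_fun f)"
  unfolding B_eq by (intro Ck_diff Ck_const Ck_sum Ck_power p_Ck)

lemma v_Ck: "Ck (Suc (Suc (Suc 0))) v"
  unfolding v_def[abs_def] by (rule Ck_powr[OF B_Ck spacelike])

lemma N_Ck: "Ck (Suc (Suc (Suc 0))) (N i)"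
  unfolding N_def[abs_def] by (intro Ck_mult v_Ck p_Ck)

lemma S_Ck: "Ck (Suc (Suc 0)) (S i j)"
  unfolding S_def by (rule Ck_partial[OF N_Ck])

lemma F_Ck: "Ck (Suc (Suc 0)) F"
  unfolding F_def[abs_def] by (intro Ck_sum Ck_mult S_Ck)

lemma q_Ck: "Ck (Suc (Suc 0)) (q k)"
  unfolding q_def[abs_def] by (intro Ck_sum Ck_mult H_Ck Ck_Suc_D[OF p_Ck])

lemma v_pos: "v x > 0"
  using spacelike[of x] by (simp add: v_def)

lemma v_square_B: "v x * v x * B_fun f x = 1"
  using spacelike[of x] by (simp add: v_def powr_minus_divide flip: powr_add)

lemma H_sym: "H i j = H j i"
  unfolding H_def by (rule partial_commute[OF f_Ck])

lemma partial_p: "partial j (p i) = H i j"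
  by (simp add: H_def p_def)

lemma sum_p_square: "v x * v x * (\<Sum>i\<in>UNIV. p i x * p i x) = v x * v x - 1"
proof -
  have "v x * v x * (1 - (\<Sum>i\<in>UNIV. p i x * p i x)) = 1"
    using v_square_B[of x] by (simp add: B_eq power2_eq_square)
  then show ?thesis unfolding right_diff_distrib by linarith
qed

lemma sum_N_square: "v x * v x = 1 + (\<Sum>i\<in>UNIV. N i x * N i x)"
  using sum_p_square[of x] by (simp add: N_def mult_ac sum_distrib_left)

lemma partial_v: "partial k v = (\<lambda>x. v x ^ 3 * q k x)"
proof
  fix x
  have "partial k (B_fun f) x = - 2 * q k x"
    unfolding B_eq by (simp add: partial_diff[OF Ck_const[of "Suc 0"] Ck_sum[OF Ck_power[OF p_Ck]]]
       partial_sum[OF Ck_power[OF p_Ck]] partial_power[OF p_Ck] partial_p q_def sum_distrib_left mult_ac sum_negf)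
  moreover have "B_fun f x powr (- 1 / 2 - 1) = v x ^ 3"
    using spacelike[of x] by (simp add: v_def powr_power)
  ultimately show "partial k v x = v x ^ 3 * q k x"
    unfolding v_def[abs_def] partial_powr[OF B_Ck spacelike] by (simp add: v_def)
qed

lemma S_eq: "S i j x = v x * H i j x + v x ^ 3 * p i x * q j x"
  unfolding S_def N_def[abs_def]
  by (simp add: partial_mult[OF v_Ck p_Ck] partial_v partial_p)

lemma sum_N_H: "(\<Sum>l\<in>UNIV. N l x * H l k x) = v x * q k x"
  by (simp add: N_def q_def sum_distrib_left mult_ac)

lemma sum_N_H': "(\<Sum>l\<in>UNIV. N l x * H k l x) = v x * q k x"
  by (subst H_sym) (rule sum_N_H)

text \<open>The shape operator is the second fundamental form with one index raised.\<close>

lemma S_ginv: "S i k x = (\<Sum>l\<in>UNIV. ginv (\<lambda>i. N i x) i l * (v x * H l k x))"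
proof -
  have "(\<Sum>l\<in>UNIV. N l x * (v x * H l k x)) = v x * (\<Sum>l\<in>UNIV. N l x * H l k x)"
    by (simp add: sum_distrib_left mult_ac)
  then show ?thesis
    unfolding sum_ginv sum_N_H by (simp add: S_eq N_def power3_eq_cube mult_ac)
qed

lemma lap_f: "lap N f x = 0"
proof -
  have "A_fun f x = B_fun f x * (\<Sum>k\<in>UNIV. H k k x) + (\<Sum>i\<in>UNIV. \<Sum>j\<in>UNIV. p i x * p j x * H i j x)"
    by (simp add: A_fun_def p_def H_def distrib_right sum.distrib sum_distrib_left mult.assoc
        if_distrib[of "\<lambda>x. x * _"] if_distrib[of "\<lambda>x. _ * x"] cong: if_cong)
  then have "v x * v x * (B_fun f x * (\<Sum>k\<in>UNIV. H k k x) + (\<Sum>i\<in>UNIV. \<Sum>j\<in>UNIV. p i x * p j x * H i j x)) = 0"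
    using zmc[of x] by simp
  then have "(v x * v x * B_fun f x) * (\<Sum>k\<in>UNIV. H k k x) + v x * v x * (\<Sum>i\<in>UNIV. \<Sum>j\<in>UNIV. p i x * p j x * H i j x) = 0"
    by (simp add: algebra_simps)
  then show ?thesis
    unfolding lap_eq v_square_B by (simp add: H_def[symmetric] N_def sum_distrib_left mult_ac)
qed

lemma trace_S: "(\<Sum>i\<in>UNIV. S i i x) = 0"
proof -
  have "(\<Sum>i\<in>UNIV. S i i x) = v x * lap N f x"
    unfolding S_ginv lap_def sum_distrib_left
    by (simp add: H_def[symmetric] H_sym[of l i for l i] mult_ac)
  then show ?thesis by (simp add: lap_f)
qed

lemma partial_lap_zero: "partial j (lap N f) x = 0"
proof -
  have "lap N f = (\<lambda>x. 0)" by (simp add: lap_f fun_eq_iff)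
  then show ?thesis by simp
qed

text \<open>Differentiating the equation lap f = 0.\<close>

lemma lap_p: "lap N (p j) x = - 2 * v x * (\<Sum>k\<in>UNIV. S k j x * q k x)"
proof -
  have "(\<Sum>k\<in>UNIV. \<Sum>l\<in>UNIV. partial j (N k) x * N l x * partial l (partial k f) x)
      = (\<Sum>k\<in>UNIV. S k j x * (\<Sum>l\<in>UNIV. N l x * H k l x))"
    by (simp add: sum_distrib_left S_def mult.assoc flip: H_def)
  also have "\<dots> = v x * (\<Sum>k\<in>UNIV. S k j x * q k x)"
    unfolding sum_N_H' by (simp add: sum_distrib_left mult_ac)
  finally show ?thesis
    using partial_lap[where N = N and j = j and x = x, OF f_Ck N_Ck] partial_lap_zero[of j x]
    unfolding p_def by linarith
qed

lemma sum_ginv_H: "v x * (\<Sum>l\<in>UNIV. ginv (\<lambda>i. N i x) k l * H j l x) = S k j x"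
  by (simp add: S_ginv sum_distrib_left H_sym[of j] mult_ac)

text \<open>In lap (v p_j) the contribution of lap p_j and the mixed term 2 gam (v, p_j) cancel.\<close>

lemma lap_N_lap_v: "lap N (N j) x = p j x * lap N v x"
proof -
  have "gam N v (p j) x = (\<Sum>k\<in>UNIV. v x ^ 3 * q k x * (\<Sum>l\<in>UNIV. ginv (\<lambda>i. N i x) k l * H j l x))"
    by (simp add: gam_def gdot_def partial_v partial_p sum_distrib_left mult_ac)
  also have "\<dots> = (\<Sum>k\<in>UNIV. v x ^ 2 * q k x * S k j x)"
    by (simp add: sum_ginv_H[symmetric] power2_eq_square power3_eq_cube mult_ac)
  also have "\<dots> = v x ^ 2 * (\<Sum>k\<in>UNIV. S k j x * q k x)"
    by (simp add: sum_distrib_left mult_ac)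
  finally show ?thesis
    unfolding N_def[of j, abs_def]
    by (simp add: lap_mult[OF v_Ck p_Ck] lap_p power2_eq_square)
qed

lemma sum_ginv_S: "(\<Sum>l\<in>UNIV. ginv (\<lambda>i. N i x) k l * S j l x) = S k j x + N j x * (\<Sum>m\<in>UNIV. S k m x * N m x)"
proof -
  have "(\<Sum>l\<in>UNIV. ginv (\<lambda>i. N i x) k l * S j l x) = (\<Sum>m\<in>UNIV. ginv (\<lambda>i. N i x) j m * S k m x)"
    unfolding S_ginv sum_distrib_left
    by (subst sum.swap) (simp add: H_sym[of l m for l m] mult_ac)
  also have "\<dots> = S k j x + N j x * (\<Sum>m\<in>UNIV. S k m x * N m x)"
    unfolding sum_ginv by (simp add: mult_ac)
  finally show ?thesis .
qed

lemma sum_N_S: "(\<Sum>j\<in>UNIV. N j x * S j k x) = v x * partial k v x"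
proof -
  have "(\<Sum>j\<in>UNIV. N j x * S j k x) = v x * (\<Sum>j\<in>UNIV. N j x * H j k x)
      + (v x * v x * (\<Sum>j\<in>UNIV. p j x * p j x)) * (v x ^ 2 * q k x)"
    by (simp add: S_eq N_def algebra_simps power2_eq_square power3_eq_cube sum.distrib sum_distrib_left)
  then show ?thesis
    unfolding sum_N_H sum_p_square by (simp add: partial_v algebra_simps power2_eq_square power3_eq_cube)
qed

lemma gam_v_v: "gam N v v x = (\<Sum>k\<in>UNIV. v x * partial k v x * (\<Sum>m\<in>UNIV. S k m x * N m x))"
proof -
  define s where "s k = (\<Sum>m\<in>UNIV. S k m x * N m x)" for k
  have s': "(\<Sum>m\<in>UNIV. N m x * S k m x) = s k" for k
    by (simp add: s_def mult_ac)
  have "v x * (\<Sum>l\<in>UNIV. ginv (\<lambda>i. N i x) k l * partial l v x) = v x * v x * s k" for k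
  proof -
    have "v x * (\<Sum>l\<in>UNIV. ginv (\<lambda>i. N i x) k l * partial l v x)
       = (\<Sum>l\<in>UNIV. ginv (\<lambda>i. N i x) k l * (v x * partial l v x))"
      by (simp add: sum_distrib_left mult_ac)
    also have "\<dots> = (\<Sum>j\<in>UNIV. N j x * (\<Sum>l\<in>UNIV. ginv (\<lambda>i. N i x) k l * S j l x))"
      unfolding sum_N_S[symmetric] sum_distrib_left by (subst sum.swap) (simp add: mult_ac)
    also have "\<dots> = s k * (1 + (\<Sum>j\<in>UNIV. N j x * N j x))"
      unfolding sum_ginv_S s_def[symmetric]
      by (simp add: distrib_left sum.distrib s' sum_distrib_left mult_ac)
    finally show ?thesis by (simp add: sum_N_square mult_ac)
  qed
  then have "(\<Sum>l\<in>UNIV. ginv (\<lambda>i. N i x) k l * partial l v x) = v x * s k" for k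
    using v_pos[of x] by (simp add: mult.assoc)
  moreover have "gam N v v x = (\<Sum>k\<in>UNIV. partial k v x * (\<Sum>l\<in>UNIV. ginv (\<lambda>i. N i x) k l * partial l v x))"
    by (simp add: gam_def gdot_def sum_distrib_left mult_ac)
  ultimately show ?thesis unfolding s_def[symmetric] by (simp add: mult_ac)
qed

text \<open>F is the Lorentzian square norm of the derivative of the unit normal (N, v).\<close>

lemma sum_gam_N: "(\<Sum>j\<in>UNIV. gam N (N j) (N j) x) = F x + gam N v v x"
proof -
  let ?s = "\<lambda>k. \<Sum>m\<in>UNIV. S k m x * N m x"
  have "gam N (N j) (N j) x = (\<Sum>k\<in>UNIV. S j k x * (\<Sum>l\<in>UNIV. ginv (\<lambda>i. N i x) k l * S j l x))" for j
    by (simp add: gam_def gdot_def sum_distrib_left S_def mult_ac)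
  then have "(\<Sum>j\<in>UNIV. gam N (N j) (N j) x) = F x + (\<Sum>j\<in>UNIV. \<Sum>k\<in>UNIV. S j k x * (N j x * ?s k))"
    by (simp add: sum_ginv_S F_def distrib_left sum.distrib)
  also have "(\<Sum>j\<in>UNIV. \<Sum>k\<in>UNIV. S j k x * (N j x * ?s k)) = (\<Sum>k\<in>UNIV. (\<Sum>j\<in>UNIV. N j x * S j k x) * ?s k)"
    unfolding sum_distrib_right by (subst sum.swap) (simp add: mult_ac)
  finally show ?thesis by (simp add: sum_N_S gam_v_v)
qed

text \<open>The relation v^2 = 1 + |N|^2 of a unit vector, to which lap is applied: lap_N_lap_v leaves lap v as
  the only unknown.\<close>

lemma lap_v: "lap N v x = v x * F x"
proof -
  have eq: "(\<lambda>x. v x * v x) = (\<lambda>x. 1 + (\<Sum>j\<in>UNIV. N j x * N j x))"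
    by (simp add: sum_N_square fun_eq_iff)
  have "lap N (\<lambda>x. 1 + (\<Sum>j\<in>UNIV. N j x * N j x)) x = (\<Sum>j\<in>UNIV. 2 * (N j x * lap N (N j) x) + 2 * gam N (N j) (N j) x)"
    by (simp add: lap_add[OF Ck_const[of "Suc (Suc 0)"] Ck_sum[OF Ck_mult[OF N_Ck N_Ck]]]
       lap_sum[OF Ck_mult[OF N_Ck N_Ck]] lap_mult[OF N_Ck N_Ck])
  also have "\<dots> = 2 * (\<Sum>j\<in>UNIV. N j x * lap N (N j) x) + 2 * (F x + gam N v v x)"
    by (simp add: sum.distrib sum_gam_N flip: sum_distrib_left)
  also have "(\<Sum>j\<in>UNIV. N j x * lap N (N j) x) = v x * (\<Sum>j\<in>UNIV. p j x * p j x) * lap N v x"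
    by (simp add: lap_N_lap_v N_def sum_distrib_left sum_distrib_right mult_ac)
  finally have "2 * (v x * lap N v x) + 2 * gam N v v x
      = 2 * (v x * (\<Sum>j\<in>UNIV. p j x * p j x) * lap N v x) + 2 * (F x + gam N v v x)"
    unfolding eq[symmetric] by (simp add: lap_mult[OF v_Ck v_Ck])
  then have "v x * lap N v x - v x * (\<Sum>j\<in>UNIV. p j x * p j x) * lap N v x = F x" by simp
  then have "v x * F x = v x * v x * lap N v x - (v x * v x * (\<Sum>j\<in>UNIV. p j x * p j x)) * lap N v x"
    by (auto simp: algebra_simps)
  then show ?thesis unfolding sum_p_square by (simp add: algebra_simps)
qed

lemma lap_N: "lap N (N j) x = F x * N j x"
  by (simp add: lap_N_lap_v lap_v N_def)

subsection \<open>Distance and support function\<close>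

text \<open>With X = (x, f x) the position vector, w is the Lorentzian product of X with the unit normal
  and r that of X with itself.\<close>

definition "w x = (\<Sum>j\<in>UNIV. N j x * x $ j) - v x * f x"
definition "r x = (\<Sum>j\<in>UNIV. x $ j * x $ j) - f x * f x"

lemma w_Ck: "Ck (Suc (Suc 0)) w"
  unfolding w_def[abs_def]
  by (intro Ck_diff Ck_sum Ck_mult Ck_coord Ck_Suc_D[OF N_Ck] Ck_Suc_D[OF v_Ck] Ck_Suc_D[OF Ck_Suc_D[OF f_Ck]])

lemma r_Ck: "Ck (Suc (Suc 0)) r"
  unfolding r_def[abs_def]
  by (intro Ck_diff Ck_sum Ck_mult Ck_coord Ck_Suc_D[OF Ck_Suc_D[OF f_Ck]])

lemma sum_ginv_p: "(\<Sum>l\<in>UNIV. ginv (\<lambda>i. N i x) k l * p l x) = v x * N k x"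
proof -
  have "(\<Sum>l\<in>UNIV. ginv (\<lambda>i. N i x) k l * p l x) = p k x * (1 + v x * v x * (\<Sum>l\<in>UNIV. p l x * p l x))"
    unfolding sum_ginv by (simp add: N_def sum_distrib_left algebra_simps)
  then show ?thesis unfolding sum_p_square by (simp add: N_def)
qed

text \<open>N and v satisfy the same equation, and the mixed terms cancel because S has trace zero.\<close>

lemma lap_w: "lap N w x = F x * w x"
proof -
  have g: "gam N v f x = (\<Sum>k\<in>UNIV. \<Sum>j\<in>UNIV. N j x * S j k x * N k x)"
  proof -
    have "gam N v f x = (\<Sum>k\<in>UNIV. partial k v x * (\<Sum>l\<in>UNIV. ginv (\<lambda>i. N i x) k l * p l x))"
      by (simp add: gam_def gdot_def sum_distrib_left mult_ac flip: p_def)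
    also have "\<dots> = (\<Sum>k\<in>UNIV. (\<Sum>j\<in>UNIV. N j x * S j k x) * N k x)"
      unfolding sum_ginv_p sum_N_S by (simp add: mult_ac)
    finally show ?thesis by (simp add: sum_distrib_right)
  qed
  have "(\<Sum>j\<in>UNIV. gam N (N j) (\<lambda>x. x $ j) x) = (\<Sum>j\<in>UNIV. (\<Sum>k\<in>UNIV. ginv (\<lambda>i. N i x) j k * S j k x))"
    by (simp add: gam_coord S_def ginv_sym)
  also have "\<dots> = (\<Sum>j\<in>UNIV. S j j x) + (\<Sum>j\<in>UNIV. \<Sum>k\<in>UNIV. N j x * S j k x * N k x)"
    unfolding sum_ginv by (simp add: sum.distrib sum_distrib_left mult_ac)
  finally have "(\<Sum>j\<in>UNIV. gam N (N j) (\<lambda>x. x $ j) x) = gam N v f x"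
    unfolding g trace_S by (subst sum.swap) simp
  then show ?thesis
    unfolding w_def[abs_def]
    by (simp add: lap_diff[OF Ck_sum[OF Ck_mult[OF Ck_Suc_D[OF N_Ck] Ck_coord]] Ck_mult[OF Ck_Suc_D[OF v_Ck] Ck_Suc_D[OF Ck_Suc_D[OF f_Ck]]]]
        lap_sum[OF Ck_mult[OF Ck_Suc_D[OF N_Ck] Ck_coord]] lap_mult[OF N_Ck Ck_coord[of "Suc (Suc 0)"]]
        lap_mult[OF v_Ck f_Ck] lap_f lap_N lap_v sum.distrib flip: sum_distrib_left[of 2])
       (simp add: algebra_simps sum_distrib_left)
qed

lemma partial_r: "partial k r x = 2 * (x $ k - f x * p k x)"
proof -
  have "(\<Sum>j\<in>UNIV. 2 * (x $ j * (if k = j then 1 else 0))) = 2 * x $ k"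
    by (simp add: if_distrib[of "\<lambda>x. _ * x"] cong: if_cong)
  then show ?thesis
    unfolding r_def[abs_def]
    by (simp add: partial_diff[OF Ck_sum[OF Ck_mult[OF Ck_coord[of "Suc 0"] Ck_coord]] Ck_mult[OF f_Ck f_Ck]]
       partial_sum[OF Ck_mult[OF Ck_coord[of "Suc 0"] Ck_coord]] partial_mult[OF Ck_coord[of "Suc 0"] Ck_coord[of "Suc 0"]]
       partial_mult[OF f_Ck f_Ck] partial_coord sum.distrib p_def[symmetric] mult.commute[of "if _ then _ else _"])
qed

text \<open>The vector x - f p is half of the gradient of r, so the gradient of w is the transposed
  shape operator applied to it.\<close>

lemma partial_w: "partial k w x = (\<Sum>j\<in>UNIV. S j k x * (x $ j - f x * p j x))"
proof -
  have "(\<Sum>j\<in>UNIV. N j x * (if k = j then 1 else 0)) = N k x"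
    by (simp add: if_distrib[of "\<lambda>x. _ * x"] cong: if_cong)
  then have "partial k w x = (\<Sum>j\<in>UNIV. S j k x * x $ j) + N k x - (partial k v x * f x + v x * p k x)"
    unfolding w_def[abs_def]
    by (simp add: partial_diff[OF Ck_sum[OF Ck_mult[OF Ck_Suc_D[OF N_Ck] Ck_coord]] Ck_mult[OF Ck_Suc_D[OF v_Ck] Ck_Suc_D[OF Ck_Suc_D[OF f_Ck]]]]
       partial_sum[OF Ck_mult[OF Ck_Suc_D[OF N_Ck] Ck_coord]] partial_mult[OF N_Ck Ck_coord[of "Suc 0"]]
       partial_mult[OF v_Ck f_Ck] partial_coord sum.distrib p_def[symmetric] S_def[symmetric])
  also have "partial k v x = (\<Sum>j\<in>UNIV. S j k x * p j x)"
    using sum_N_S[of x k] v_pos[of x]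
    by (simp add: N_def mult.assoc mult.commute[of "p j x" for j] flip: sum_distrib_left)
  finally show ?thesis
    by (simp add: N_def right_diff_distrib sum_subtractf sum_distrib_right sum_distrib_left mult_ac)
qed

lemma lap_r: "lap N r x = 2 * real CARD('n)"
proof -
  have c: "gam N (\<lambda>x. x $ j) (\<lambda>x. x $ j) x = 1 + N j x * N j x" for j
    by (simp add: gam_coord partial_coord ginv_def if_distrib[of "\<lambda>x. _ * x"] cong: if_cong)
  have "gam N f f x = (\<Sum>k\<in>UNIV. p k x * (\<Sum>l\<in>UNIV. ginv (\<lambda>i. N i x) k l * p l x))"
    by (simp add: gam_def gdot_def sum_distrib_left mult_ac flip: p_def)
  also have "\<dots> = (\<Sum>k\<in>UNIV. N k x * N k x)"
    unfolding sum_ginv_p by (simp add: N_def mult_ac)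
  finally have "gam N f f x = (\<Sum>k\<in>UNIV. N k x * N k x)" .
  then show ?thesis
    unfolding r_def[abs_def]
    by (simp add: lap_diff[OF Ck_sum[OF Ck_mult[OF Ck_coord[of "Suc (Suc 0)"] Ck_coord]] Ck_mult[OF f_Ck f_Ck]]
        lap_sum[OF Ck_mult[OF Ck_coord[of "Suc (Suc 0)"] Ck_coord]] lap_mult[OF Ck_coord[of "Suc (Suc 0)"] Ck_coord[of "Suc (Suc 0)"]]
        lap_mult[OF f_Ck f_Ck] lap_f c sum.distrib flip: sum_distrib_left)
qed

text \<open>The gradient of r is twice the tangential part of the position vector X, whose Lorentzian square is
  that of X plus w^2 because the normal part is time-like.\<close>

lemma gam_r_r: "gam N r r x = 4 * (r x + (w x)\<^sup>2)"
proof -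
  define s where "s = (\<Sum>k\<in>UNIV. p k x * x $ k)"
  define P where "P = (\<Sum>k\<in>UNIV. p k x * p k x)"
  have vP: "v x * v x * P = v x * v x - 1" unfolding P_def by (rule sum_p_square)
  define y where "y k = x $ k - f x * p k x" for k
  have "(\<Sum>k\<in>UNIV. y k * y k) = (\<Sum>j\<in>UNIV. x $ j * x $ j) - 2 * f x * s + f x * f x * P"
    by (simp add: y_def s_def P_def algebra_simps sum.distrib sum_subtractf sum_distrib_left)
  moreover have "(\<Sum>k\<in>UNIV. N k x * y k) = v x * s - f x * v x * P"
    by (simp add: y_def s_def P_def N_def algebra_simps sum_subtractf sum_distrib_left)
  moreover have "w x = v x * s - v x * f x"
    by (simp add: w_def s_def N_def mult_ac sum_distrib_left)
  moreover have "gam N r r x = 4 * gdot (\<lambda>i. N i x) y y"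
    unfolding gam_def partial_r y_def[symmetric] gdot_scale gdot_scale_right by simp
  ultimately have e: "gam N r r x = 4 * ((\<Sum>j\<in>UNIV. x $ j * x $ j) - 2 * f x * s + f x * f x * P + (v x * s - f x * v x * P)\<^sup>2)"
    "w x = v x * s - v x * f x"
    by (simp_all add: gdot_eq power2_eq_square)
  have vP': "P * (v x * v x - 1) = v x * v x - 1 - P"
    using vP by (simp add: algebra_simps)
  have "(v x * s - f x * v x * P)\<^sup>2 = v x * v x * s * s - 2 * s * f x * (v x * v x * P) + f x * f x * P * (v x * v x * P)"
    by (simp add: power2_eq_square algebra_simps)
  also have "\<dots> = v x * v x * s * s - 2 * s * f x * (v x * v x - 1) + f x * f x * (P * (v x * v x - 1))"
    unfolding vP by simp
  also have "\<dots> = (w x)\<^sup>2 + 2 * s * f x - f x * f x - f x * f x * P"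
    unfolding vP' e(2) by (simp add: power2_eq_square algebra_simps)
  finally show ?thesis unfolding e(1) r_def by simp
qed

subsection \<open>Simons inequality\<close>

definition "K i m k = partial k (S i m)"

lemma K_sym: "K i m k = K i k m"
  unfolding K_def S_def by (rule partial_commute[OF N_Ck])

lemma partial_q: "partial k (q m) x = (\<Sum>j\<in>UNIV. H j k x * H j m x) + (\<Sum>j\<in>UNIV. p j x * partial k (H j m) x)"
  unfolding q_def[abs_def]
  by (simp add: partial_sum[OF Ck_mult[OF Ck_Suc_D[OF p_Ck] H_Ck]] partial_mult[OF p_Ck H_Ck] partial_p sum.distrib)

lemma K_eq: "K i m k x = v x * partial k (H i m) x + v x ^ 3 * (q k x * H i m x + q m x * H i k x)
   + 3 * v x ^ 5 * p i x * q k x * q m x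
   + v x ^ 3 * p i x * ((\<Sum>j\<in>UNIV. H j k x * H j m x) + (\<Sum>j\<in>UNIV. p j x * partial k (H j m) x))"
proof -
  have S': "S i m = (\<lambda>x. v x * H i m x + v x ^ 3 * p i x * q m x)"
    by (simp add: S_eq fun_eq_iff)
  have c: "Ck (Suc (Suc 0)) (\<lambda>x. v x ^ 3)" "Ck (Suc (Suc 0)) (\<lambda>x. v x ^ 3 * p i x)" "Ck (Suc (Suc 0)) v"
    by (intro Ck_power Ck_mult Ck_Suc_D[OF v_Ck] Ck_Suc_D[OF p_Ck])+
  show ?thesis
    unfolding K_def S'
    by (simp add: partial_add[OF Ck_mult[OF c(3) H_Ck] Ck_mult[OF c(2) q_Ck]] partial_mult[OF c(3) H_Ck]
        partial_mult[OF c(2) q_Ck] partial_mult[OF c(1) p_Ck] partial_power[OF v_Ck] partial_v partial_p partial_q)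
       (simp add: algebra_simps eval_nat_numeral)
qed

lemma partial_F: "partial m F x = 2 * (\<Sum>k\<in>UNIV. \<Sum>i\<in>UNIV. S k i x * K i k m x)"
proof -
  have "partial m F x = (\<Sum>k\<in>UNIV. \<Sum>i\<in>UNIV. K k i m x * S i k x) + (\<Sum>k\<in>UNIV. \<Sum>i\<in>UNIV. S k i x * K i k m x)"
    unfolding F_def[abs_def]
    by (simp add: partial_sum[OF Ck_sum[OF Ck_mult[OF S_Ck S_Ck]]] partial_sum[OF Ck_mult[OF S_Ck S_Ck]]
        partial_mult[OF S_Ck S_Ck] sum.distrib flip: K_def)
  also have "(\<Sum>k\<in>UNIV. \<Sum>i\<in>UNIV. K k i m x * S i k x) = (\<Sum>k\<in>UNIV. \<Sum>i\<in>UNIV. S k i x * K i k m x)"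
    by (subst sum.swap) (simp add: mult_ac)
  finally show ?thesis by simp
qed

lemma lap_S: "lap N (S i m) x = partial m F x * N i x + F x * S i m x
   - 2 * (\<Sum>k\<in>UNIV. S k m x * (\<Sum>l\<in>UNIV. N l x * K i k l x))"
proof -
  have "lap N (N i) = (\<lambda>x. F x * N i x)" by (simp add: lap_N fun_eq_iff)
  then have "partial m (lap N (N i)) x = partial m F x * N i x + F x * S i m x"
    by (simp add: partial_mult[OF F_Ck N_Ck] S_def)
  then show ?thesis
    using partial_lap[where N = N and j = m and x = x and u = "N i", OF N_Ck N_Ck]
    by (simp add: S_def[symmetric] K_def[symmetric] sum_distrib_left mult.assoc)
qed

text \<open>Here t is the covariant derivative of the second fundamental form. Its symmetry is the Codazzi
  equation, and its explicit form is read off from third derivatives of f.\<close>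

lemma simons_pointwise:
  defines "b \<equiv> \<lambda>m x. \<Sum>j\<in>UNIV. S m j x * N j x"
  shows "(\<Sum>i\<in>UNIV. \<Sum>m\<in>UNIV. gam N (S i m) (S m i) x)
     + 2 * (\<Sum>m\<in>UNIV. b m x * (\<Sum>k\<in>UNIV. \<Sum>i\<in>UNIV. S k i x * K i k m x))
     - 2 * (\<Sum>i\<in>UNIV. \<Sum>k\<in>UNIV. (\<Sum>j\<in>UNIV. S k j x * S j i x) * (\<Sum>l\<in>UNIV. N l x * K i k l x)) \<ge> 0"
proof -
  define y where "y k m = (\<Sum>j\<in>UNIV. (v x * H k j x) * S j m x)" for k m
  define t where "t i m k = v x * partial k (H i m) x + v x ^ 3 * (q k x * H i m x + q m x * H i k x + q i x * H m k x)" for i m k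
  define pq where "pq = (\<Sum>j\<in>UNIV. p j x * q j x)"
  have Hp: "(\<Sum>j\<in>UNIV. H i j x * p j x) = q i x" for i
    by (simp add: q_def H_sym[of i] mult_ac)
  have y': "y k m = v x ^ 2 * (\<Sum>j\<in>UNIV. H j k x * H j m x) + v x ^ 4 * q k x * q m x" for k m
  proof -
    have "y k m = v x ^ 2 * (\<Sum>j\<in>UNIV. H k j x * H j m x) + v x ^ 4 * (\<Sum>j\<in>UNIV. H k j x * p j x) * q m x"
      by (simp add: y_def S_eq algebra_simps sum.distrib sum_distrib_left sum_distrib_right eval_nat_numeral)
    then show ?thesis unfolding Hp by (simp add: H_sym[of k])
  qed
  have b': "b i x = v x ^ 2 * q i x + v x ^ 4 * p i x * pq" for i
  proof -
    have "b i x = v x ^ 2 * (\<Sum>j\<in>UNIV. H i j x * p j x) + v x ^ 4 * p i x * pq"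
      by (simp add: b_def S_eq N_def pq_def algebra_simps sum.distrib sum_distrib_left eval_nat_numeral)
    then show ?thesis by (simp add: Hp)
  qed
  have "(\<Sum>i\<in>UNIV. \<Sum>m\<in>UNIV. gdot (\<lambda>i. N i x) (\<lambda>k. K i m k x) (\<lambda>k. K m i k x))
     + 2 * (\<Sum>m\<in>UNIV. b m x * (\<Sum>k\<in>UNIV. \<Sum>i\<in>UNIV. S k i x * K i k m x))
     - 2 * (\<Sum>i\<in>UNIV. \<Sum>k\<in>UNIV. (\<Sum>j\<in>UNIV. S k j x * S j i x) * (\<Sum>l\<in>UNIV. N l x * K i k l x)) \<ge> 0"
  proof (rule simons_algebra[where h = "\<lambda>i j. v x * H i j x" and y = y and t = t])
    show "v x * H i j x = v x * H j i x" for i j by (simp add: H_sym[of i])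
    show "S i k x = (\<Sum>l\<in>UNIV. ginv (\<lambda>i. N i x) i l * (v x * H l k x))" for i k by (rule S_ginv)
    show "b i x = (\<Sum>j\<in>UNIV. S i j x * N j x)" for i by (simp add: b_def)
    show "y k m = (\<Sum>j\<in>UNIV. v x * H k j x * S j m x)" for k m by (simp add: y_def)
    show "t i m k = t m i k" for i m k
      by (simp add: t_def H_sym[of m i] algebra_simps)
    show "K i m k x = K i k m x" for i m k by (simp add: K_sym[of i m])
    show "K i m k x = (\<Sum>l\<in>UNIV. ginv (\<lambda>i. N i x) i l * t l m k) + N i x * y k m - v x * H k m x * b i x" for i m k
    proof -
      have "(\<Sum>l\<in>UNIV. N l x * t l m k) = v x ^ 2 * (\<Sum>l\<in>UNIV. p l x * partial k (H l m) x)
          + v x ^ 4 * (q k x * (\<Sum>l\<in>UNIV. p l x * H l m x) + q m x * (\<Sum>l\<in>UNIV. p l x * H l k x) + pq * H m k x)"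
        by (simp add: N_def t_def pq_def algebra_simps sum.distrib sum_distrib_left eval_nat_numeral)
      also have "\<dots> = v x ^ 2 * (\<Sum>l\<in>UNIV. p l x * partial k (H l m) x)
          + v x ^ 4 * (2 * q k x * q m x + pq * H m k x)"
        by (simp add: q_def[symmetric])
      finally show ?thesis
        unfolding sum_ginv K_eq y' b' t_def N_def
        by (simp add: H_sym[of k m] algebra_simps eval_nat_numeral)
    qed
  qed
  then show ?thesis by (simp add: gam_def K_def)
qed

text \<open>The term F S of lap S contributes F^2 twice. All other terms, those from the derivatives of
  the coefficients of lap included, add up to twice the squared norm of the covariant derivative
  of S.\<close>

lemma simons: "lap N F x \<ge> 2 * (F x)\<^sup>2"
proof -
  define b where "b m x = (\<Sum>j\<in>UNIV. S m j x * N j x)" for m x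
  define W where "W i k = (\<Sum>l\<in>UNIV. N l x * K i k l x)" for i k
  note lap_S' = lap_S[of _ _ x, folded W_def]
  have "lap N F x = (\<Sum>i\<in>UNIV. \<Sum>m\<in>UNIV. S i m x * lap N (S m i) x + S m i x * lap N (S i m) x + 2 * gam N (S i m) (S m i) x)"
    unfolding F_def[abs_def]
    by (simp add: lap_sum[OF Ck_sum[OF Ck_mult[OF S_Ck S_Ck]]] lap_sum[OF Ck_mult[OF S_Ck S_Ck]] lap_mult[OF S_Ck S_Ck])
  also have "\<dots> = (\<Sum>i\<in>UNIV. \<Sum>m\<in>UNIV. S i m x * lap N (S m i) x) + (\<Sum>i\<in>UNIV. \<Sum>m\<in>UNIV. S m i x * lap N (S i m) x)
      + 2 * (\<Sum>i\<in>UNIV. \<Sum>m\<in>UNIV. gam N (S i m) (S m i) x)"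
    by (simp add: sum.distrib sum_distrib_left)
  also have "(\<Sum>i\<in>UNIV. \<Sum>m\<in>UNIV. S i m x * lap N (S m i) x) = (\<Sum>i\<in>UNIV. \<Sum>m\<in>UNIV. S m i x * lap N (S i m) x)"
    by (rule sum.swap)
  also have "(\<Sum>i\<in>UNIV. \<Sum>m\<in>UNIV. S m i x * lap N (S i m) x)
    = (\<Sum>m\<in>UNIV. partial m F x * b m x) + (F x)\<^sup>2
      - 2 * (\<Sum>i\<in>UNIV. \<Sum>k\<in>UNIV. (\<Sum>j\<in>UNIV. S k j x * S j i x) * (\<Sum>l\<in>UNIV. N l x * K i k l x))"
  proof -
    have "(\<Sum>i\<in>UNIV. \<Sum>m\<in>UNIV. S m i x * lap N (S i m) x) =
      (\<Sum>i\<in>UNIV. \<Sum>m\<in>UNIV. partial m F x * (S m i x * N i x)) + (\<Sum>i\<in>UNIV. \<Sum>m\<in>UNIV. F x * (S i m x * S m i x))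
      - 2 * (\<Sum>i\<in>UNIV. \<Sum>m\<in>UNIV. \<Sum>k\<in>UNIV. (S k m x * S m i x) * W i k)"
      by (simp add: lap_S' algebra_simps sum_subtractf sum.distrib sum_distrib_left)
    also have "(\<Sum>i\<in>UNIV. \<Sum>m\<in>UNIV. partial m F x * (S m i x * N i x)) = (\<Sum>m\<in>UNIV. partial m F x * b m x)"
      unfolding b_def sum_distrib_left by (rule sum.swap)
    also have "(\<Sum>i\<in>UNIV. \<Sum>m\<in>UNIV. F x * (S i m x * S m i x)) = (F x)\<^sup>2"
      by (simp add: F_def power2_eq_square flip: sum_distrib_left)
    also have "(\<Sum>i\<in>UNIV. \<Sum>m\<in>UNIV. \<Sum>k\<in>UNIV. (S k m x * S m i x) * W i k)
       = (\<Sum>i\<in>UNIV. \<Sum>k\<in>UNIV. (\<Sum>j\<in>UNIV. S k j x * S j i x) * W i k)"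
      unfolding sum_distrib_right by (rule sum.cong[OF refl], rule sum.swap)
    finally show ?thesis unfolding W_def .
  qed
  also have "(\<Sum>m\<in>UNIV. partial m F x * b m x) = 2 * (\<Sum>m\<in>UNIV. b m x * (\<Sum>k\<in>UNIV. \<Sum>i\<in>UNIV. S k i x * K i k m x))"
    unfolding partial_F by (subst sum_distrib_left) (simp add: mult_ac)
  finally show ?thesis
    using simons_pointwise[of x] unfolding b_def by linarith
qed

lemma F_nonneg: "F x \<ge> 0"
  unfolding F_def
  by (rule trace_square_ginv_nonneg[OF _ S_ginv]) (simp add: H_sym)

lemma F_eq_0D: "F x = 0 \<Longrightarrow> H i j x = 0"
proof -
  assume "F x = 0"
  then have "v x * H i j x = 0"
    by (intro trace_square_ginv_eq_0D[where X = "\<lambda>i j. v x * H i j x" and M = "\<lambda>i j. S i j x", OF _ S_ginv])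
       (auto simp: F_def H_sym[of i j for i j])
  then show ?thesis using v_pos[of x] by simp
qed

end


section \<open>Decay of the curvature\<close>

text \<open>Mean value theorem and the Cauchy-Schwarz inequality, since |Df|^2 = 1 - B.\<close>

lemma increment_le:
  fixes f :: "real ^ 'n \<Rightarrow> real"
  assumes f: "Ck (Suc k) f"
  obtains z where "(f y - f x)\<^sup>2 \<le> (norm (y - x))\<^sup>2 * (1 - B_fun f z)"
proof -
  define d where "d = y - x"
  obtain t where "f (x + 1 *\<^sub>R d) - f (x + 0 *\<^sub>R d) = (1 - 0) * (\<Sum>i\<in>UNIV. d $ i * partial i f (x + t *\<^sub>R d))"
    using MVT2[of 0 1 "\<lambda>t. f (x + t *\<^sub>R d)" "\<lambda>t. \<Sum>i\<in>UNIV. d $ i * partial i f (x + t *\<^sub>R d)"]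
      has_derivative_line[OF f, of x d] by auto
  then have "f y - f x = d \<bullet> (\<chi> i. partial i f (x + t *\<^sub>R d))"
    by (simp add: inner_vec_def d_def)
  then have "(f y - f x)\<^sup>2 \<le> (d \<bullet> d) * ((\<chi> i. partial i f (x + t *\<^sub>R d)) \<bullet> (\<chi> i. partial i f (x + t *\<^sub>R d)))"
    by (simp only: Cauchy_Schwarz_ineq)
  also have "\<dots> = (norm (y - x))\<^sup>2 * (1 - B_fun f (x + t *\<^sub>R d))"
    by (simp add: power2_norm_eq_inner d_def B_fun_def) (simp add: inner_vec_def power2_eq_square)
  finally show ?thesis by (rule that)
qed

lemma constant_if_partial_zero:
  fixes u :: "real ^ 'n \<Rightarrow> real"
  assumes u: "Ck (Suc k) u" and 0: "\<And>i x. partial i u x = 0"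
  shows "u x = u y"
proof -
  have "u (y + 1 *\<^sub>R (x - y)) = u (y + 0 *\<^sub>R (x - y))"
    by (rule DERIV_isconst_all[of "\<lambda>t. u (y + t *\<^sub>R (x - y))"])
       (use has_derivative_line[OF u, of y "x - y"] in \<open>simp add: 0\<close>)
  then show ?thesis by simp
qed

lemma lap_power:
  assumes u: "Ck (Suc (Suc k)) u"
  shows "lap N (\<lambda>x. u x ^ Suc (Suc m)) x = real (m + 2) * u x ^ Suc m * lap N u x
     + real (m + 2) * real (m + 1) * u x ^ m * gam N u u x"
proof (induction m)
  case 0
  then show ?case by (simp add: lap_mult[OF u u])
next
  case (Suc m)
  have "gam N u (\<lambda>x. u x ^ Suc (Suc m)) x = real (m + 2) * u x ^ Suc m * gam N u u x"
    unfolding gam_def partial_power[OF u] gdot_scale_right[symmetric] by simp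
  moreover have "lap N (\<lambda>x. u x ^ Suc (Suc (Suc m))) x = u x * lap N (\<lambda>x. u x ^ Suc (Suc m)) x
      + u x ^ Suc (Suc m) * lap N u x + 2 * gam N u (\<lambda>x. u x ^ Suc (Suc m)) x"
    using lap_mult[OF u Ck_power[OF u, of "Suc (Suc m)"], of N x] by simp
  ultimately show ?case
    unfolding Suc by (simp add: algebra_simps)
qed

context maximal_graph begin

lemma strictly_lipschitz:
  assumes "x \<noteq> y"
  shows "\<bar>f y - f x\<bar> < norm (y - x)"
proof -
  obtain z where "(f y - f x)\<^sup>2 \<le> (norm (y - x))\<^sup>2 * (1 - B_fun f z)"
    using increment_le[OF f_Ck] by blast
  also have "\<dots> < (norm (y - x))\<^sup>2 * 1"
    using assms spacelike[of z] by (intro mult_strict_left_mono) auto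
  finally have "\<bar>f y - f x\<bar>\<^sup>2 < (norm (y - x))\<^sup>2" by simp
  then show ?thesis by (rule power2_less_imp_less) simp
qed

lemma r_eq: "r x = (norm x)\<^sup>2 - (f x)\<^sup>2"
proof -
  have "(norm x)\<^sup>2 = (\<Sum>j\<in>UNIV. x $ j * x $ j)"
    by (simp only: power2_norm_eq_inner inner_vec_def inner_real_def)
  then show ?thesis unfolding r_def by (simp only: power2_eq_square)
qed

lemma r_continuous: "continuous_on UNIV r"
  by (rule Ck_continuous[OF r_Ck])

context
  assumes f0: "f 0 = 0"
begin

lemma r_nonneg: "r x \<ge> 0"
proof -
  have "\<bar>f x\<bar> \<le> norm x"
    using strictly_lipschitz[of 0 x] f0 by (cases "x = 0") auto
  then have "\<bar>f x\<bar>\<^sup>2 \<le> (norm x)\<^sup>2" by (intro power_mono) auto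
  then show ?thesis by (simp add: r_eq)
qed

text \<open>Along rays from the origin |x| - |f x| does not decrease, f being 1-Lipschitz, and on the unit sphere
  it has a positive minimum.\<close>

lemma r_grows_linearly:
  obtains \<delta> where "\<delta> > 0" "\<And>x. norm x \<ge> 1 \<Longrightarrow> r x \<ge> \<delta> * norm x"
proof -
  have "continuous_on (sphere 0 1) (\<lambda>x. 1 - \<bar>f x\<bar>)"
    by (intro continuous_intros continuous_on_subset[OF Ck_continuous[OF f_Ck]]) auto
  moreover have "axis undefined 1 \<in> sphere (0 :: real ^ 'n) 1"
    by (simp add: dist_norm norm_axis_1)
  ultimately obtain z where "z \<in> sphere 0 1" "\<forall>x\<in>sphere 0 1. 1 - \<bar>f z\<bar> \<le> 1 - \<bar>f x\<bar>"
    using continuous_attains_inf[OF compact_sphere, of "0 :: real ^ 'n" 1 "\<lambda>x. 1 - \<bar>f x\<bar>"] by blast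
  then have z: "norm z = 1" "\<And>x. norm x = 1 \<Longrightarrow> 1 - \<bar>f z\<bar> \<le> 1 - \<bar>f x\<bar>"
    by (auto simp: dist_norm)
  have pos: "1 - \<bar>f z\<bar> > 0"
    using strictly_lipschitz[of 0 z] f0 z(1) by (cases "z = 0") auto
  have "r x \<ge> (1 - \<bar>f z\<bar>) * norm x" if x: "norm x \<ge> 1" for x
  proof -
    define y where "y = (1 / norm x) *\<^sub>R x"
    have y: "norm y = 1" using x by (auto simp: y_def)
    have "x - y = (1 - 1 / norm x) *\<^sub>R x" by (simp add: y_def algebra_simps)
    then have "norm (x - y) = \<bar>1 - 1 / norm x\<bar> * norm x" by simp
    also have "\<dots> = norm x - 1" using x by (cases "x = 0") (auto simp: field_simps abs_if)
    finally have "\<bar>f x - f y\<bar> \<le> norm x - 1"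
      using strictly_lipschitz[of y x] by (cases "x = y") auto
    then have 1: "norm x - \<bar>f x\<bar> \<ge> 1 - \<bar>f z\<bar>" using z(2)[OF y] by linarith
    have "r x = (norm x - \<bar>f x\<bar>) * (norm x + \<bar>f x\<bar>)"
      by (simp add: r_eq power2_eq_square algebra_simps)
    also have "\<dots> \<ge> (1 - \<bar>f z\<bar>) * norm x"
      using 1 pos by (intro mult_mono) auto
    finally show ?thesis .
  qed
  with pos show ?thesis by (rule that)
qed

lemma r_sublevel_compact: "compact {x. r x \<le> c}"
proof -
  obtain \<delta> where d: "\<delta> > 0" "\<And>x. norm x \<ge> 1 \<Longrightarrow> r x \<ge> \<delta> * norm x"
    using r_grows_linearly by blast
  have "norm x \<le> max 1 (c / \<delta>)" if "r x \<le> c" for x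
  proof (cases "norm x \<ge> 1")
    case True
    then have "norm x \<le> c / \<delta>" using d(2)[OF True] d(1) that by (simp add: field_simps)
    then show ?thesis by simp
  qed auto
  then have "bounded {x. r x \<le> c}" by (auto simp: bounded_iff)
  moreover have "closed {x. r x \<le> c}"
    by (rule closed_Collect_le[OF r_continuous continuous_on_const])
  ultimately show ?thesis by (simp add: compact_eq_bounded_closed)
qed

text \<open>The cutoff vanishes on the boundary of the compact set where r \<le> \<rho>. A positive maximum is
  therefore attained in the interior, where the second derivative test applies.\<close>

lemma cutoff_bound:
  assumes u: "continuous_on UNIV u" "\<And>x. u x \<ge> 0" and m: "m > 0" and C: "C \<ge> 0"
    and step: "\<And>x. r x < \<rho> \<Longrightarrow> u x > 0 \<Longrightarrow>
       \<forall>\<^sub>F y in nhds x. (\<rho> - r y) ^ m * u y \<le> (\<rho> - r x) ^ m * u x \<Longrightarrow> (\<rho> - r x) ^ m * u x \<le> C"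
    and x: "r x \<le> \<rho>"
  shows "(\<rho> - r x) ^ m * u x \<le> C"
proof -
  let ?D = "{x. r x \<le> \<rho>}" and ?g = "\<lambda>x. (\<rho> - r x) ^ m * u x"
  have "continuous_on ?D ?g"
    by (intro continuous_intros continuous_on_subset[OF u(1)] continuous_on_subset[OF r_continuous]) auto
  then obtain z where z: "r z \<le> \<rho>" "\<And>y. r y \<le> \<rho> \<Longrightarrow> ?g y \<le> ?g z"
    using continuous_attains_sup[OF r_sublevel_compact, of \<rho> ?g] x by auto
  have "?g z \<le> C"
  proof (cases "?g z > 0")
    case True
    then have "r z \<noteq> \<rho>" using m by (intro notI) (simp add: zero_power)
    with z have rz: "r z < \<rho>" by simp
    have uz: "u z > 0" using True u(2)[of z] by (cases "u z = 0") auto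
    have "open {y. r y < \<rho>}"
      by (rule open_Collect_less[OF r_continuous continuous_on_const])
    then have "\<forall>\<^sub>F y in nhds z. y \<in> {y. r y < \<rho>}"
      by (rule eventually_nhds_in_open) (simp add: rz)
    then have "\<forall>\<^sub>F y in nhds z. ?g y \<le> ?g z"
      by (rule eventually_mono) (auto intro: z(2))
    then show ?thesis by (rule step[OF rz uz])
  qed (use C in auto)
  then show ?thesis using z(2)[OF x] by linarith
qed

lemma cutoff_Ck: "Ck (Suc (Suc 0)) (\<lambda>x. \<rho> - r x)"
  by (intro Ck_diff Ck_const r_Ck)

lemma partial_cutoff: "partial k (\<lambda>x. \<rho> - r x) = (\<lambda>x. - partial k r x)"
  by (simp add: partial_diff[OF Ck_const[of "Suc 0"] r_Ck])

lemma lap_cutoff: "lap N (\<lambda>x. \<rho> - r x) x = - 2 * real CARD('n)"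
  by (simp add: lap_diff[OF Ck_const[of "Suc (Suc 0)"] r_Ck] lap_r)

lemma gam_cutoff_left: "gam N (\<lambda>x. \<rho> - r x) u x = - gam N r u x"
  using gdot_scale[of _ "-1"] by (simp add: gam_def partial_cutoff)

lemma gam_cutoff: "gam N (\<lambda>x. \<rho> - r x) (\<lambda>x. \<rho> - r x) x = gam N r r x"
  by (simp add: gam_cutoff_left) (simp add: gam_cutoff_left gam_sym[of N r "\<lambda>x. \<rho> - r x"])

text \<open>At the maximum the gradients of w and r are parallel. Since the former is the shape operator applied
  to half of the latter, the gradient of r is an eigenvector of S with eigenvalue 2 \<kappa>, and
  eigenvalue_le_trace_square bounds F below. Inserted into lap \<le> 0, this bound competes with the
  negative terms of order w^2 that come from the cutoff. It wins by the factor n / (n - 1), and the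
  exponent 4 (n - 1) of the cutoff is large enough to make that visible.\<close>

lemma support_bound_step:
  assumes card: "CARD('n) \<ge> 2" and rx: "r x < \<rho>" and wx: "w x \<noteq> 0"
    and max: "\<forall>\<^sub>F y in nhds x. (\<rho> - r y) ^ (4 * (CARD('n) - 1)) * (w y * w y)
                \<le> (\<rho> - r x) ^ (4 * (CARD('n) - 1)) * (w x * w x)"
  shows "w x * w x \<le> (2 * real CARD('n) - 1) * \<rho>"
proof -
  define n where "n = real CARD('n)"
  obtain m where m: "4 * (CARD('n) - 1) = Suc (Suc m)"
  proof
    show "4 * (CARD('n) - 1) = Suc (Suc (4 * (CARD('n) - 1) - 2))" using card by linarith
  qed
  define \<alpha> where "\<alpha> = real m + 2"
  have alpha: "\<alpha> = 4 * (n - 1)"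
    using card arg_cong[OF m, of real] by (simp add: \<alpha>_def n_def of_nat_diff)
  have n: "n \<ge> 2" using card by (simp add: n_def)
  define a where "a = \<rho> - r x"
  have a: "a > 0" using rx by (simp add: a_def)
  define G where "G = gam N r r x"
  let ?A = "\<lambda>x. (\<rho> - r x) ^ Suc (Suc m)" and ?W = "\<lambda>x. w x * w x"
  note ck = Ck_power[OF cutoff_Ck[of \<rho>], where m = "Suc (Suc m)"] Ck_mult[OF w_Ck w_Ck]
  have max': "\<forall>\<^sub>F y in nhds x. ?A y * ?W y \<le> ?A x * ?W x"
    using max unfolding m by simp
  \<comment> \<open>the factor between the gradients of w and r, from the vanishing of the gradient at the maximum\<close>
  define \<kappa> where "\<kappa> = \<alpha> * w x / (2 * a)"
  have Dw: "partial k w x = \<kappa> * partial k r x" for k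
  proof -
    have "partial k (\<lambda>x. ?A x * ?W x) x = 0"
      by (rule lap_local_max(2)[OF Ck_mult[OF ck] max'])
    then have "a ^ Suc m * w x * (2 * a * partial k w x - \<alpha> * w x * partial k r x) = 0"
      by (simp only: partial_mult[OF ck] partial_mult[OF w_Ck w_Ck] partial_power[OF cutoff_Ck] partial_cutoff a_def[symmetric])
         (simp add: \<alpha>_def algebra_simps)
    then have "2 * a * partial k w x = \<alpha> * w x * partial k r x"
      using a wx by simp
    then show ?thesis using a by (simp add: \<kappa>_def field_simps)
  qed
  have gw: "gam N w w x = \<kappa> * \<kappa> * G" and gr: "gam N r w x = \<kappa> * G"
    unfolding gam_def Dw gdot_scale gdot_scale_right G_def by simp_all
  have gAW: "gam N ?A ?W x = - (2 * \<alpha> * a ^ Suc m * w x * \<kappa> * G)"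
  proof -
    have "gam N ?A ?W x = gdot (\<lambda>i. N i x) (\<lambda>k. - (\<alpha> * a ^ Suc m) * partial k r x) (\<lambda>k. 2 * w x * partial k w x)"
      unfolding gam_def partial_power[OF cutoff_Ck] partial_mult[OF w_Ck w_Ck] partial_cutoff
      by (simp add: a_def \<alpha>_def algebra_simps)
    also have "\<dots> = - (\<alpha> * a ^ Suc m) * (2 * w x * gam N r w x)"
      unfolding gdot_scale gdot_scale_right gam_def by simp
    finally show ?thesis by (simp add: gr)
  qed
  have lA: "lap N ?A x = - (2 * n * \<alpha> * a ^ Suc m) + \<alpha> * (\<alpha> - 1) * a ^ m * G"
    unfolding lap_power[OF cutoff_Ck] lap_cutoff gam_cutoff by (simp add: \<alpha>_def n_def a_def G_def algebra_simps)
  have lW: "lap N ?W x = 2 * F x * w x * w x + 2 * \<kappa> * \<kappa> * G"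
    by (simp add: lap_mult[OF w_Ck w_Ck] lap_w gw)
  have "lap N (\<lambda>x. ?A x * ?W x) x \<le> 0"
    by (rule lap_local_max(1)[OF Ck_mult[OF ck] max'])
  then have "a ^ Suc (Suc m) * (2 * F x * w x * w x + 2 * \<kappa> * \<kappa> * G)
      + w x * w x * (- (2 * n * \<alpha> * a ^ Suc m) + \<alpha> * (\<alpha> - 1) * a ^ m * G)
      - 4 * \<alpha> * a ^ Suc m * w x * \<kappa> * G \<le> 0"
    unfolding lap_mult[OF ck] lA lW gAW by (simp add: a_def)
  also have "a ^ Suc (Suc m) * (2 * F x * w x * w x + 2 * \<kappa> * \<kappa> * G)
      + w x * w x * (- (2 * n * \<alpha> * a ^ Suc m) + \<alpha> * (\<alpha> - 1) * a ^ m * G)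
      - 4 * \<alpha> * a ^ Suc m * w x * \<kappa> * G
    = a ^ m * (w x * w x) * (2 * F x * a\<^sup>2 - 2 * n * \<alpha> * a - (\<alpha> * \<alpha> / 2 + \<alpha>) * G)"
  proof -
    have "a * a * \<kappa> * \<kappa> = \<alpha> * \<alpha> * (w x * w x) / 4" "a * w x * \<kappa> = \<alpha> * (w x * w x) / 2"
      using a by (simp_all add: \<kappa>_def field_simps)
    note \<kappa> = this
    have "a ^ Suc (Suc m) * (2 * F x * w x * w x + 2 * \<kappa> * \<kappa> * G)
      + w x * w x * (- (2 * n * \<alpha> * a ^ Suc m) + \<alpha> * (\<alpha> - 1) * a ^ m * G)
      - 4 * \<alpha> * a ^ Suc m * w x * \<kappa> * G
     = a ^ m * (2 * F x * (w x * w x) * a\<^sup>2 + 2 * (a * a * \<kappa> * \<kappa>) * G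
      + w x * w x * (- (2 * n * \<alpha> * a) + \<alpha> * (\<alpha> - 1) * G) - 4 * \<alpha> * (a * w x * \<kappa>) * G)"
      by (simp add: power2_eq_square algebra_simps)
    also have "\<dots> = a ^ m * (w x * w x) * (2 * F x * a\<^sup>2 - 2 * n * \<alpha> * a - (\<alpha> * \<alpha> / 2 + \<alpha>) * G)"
      unfolding \<kappa> by (simp add: algebra_simps)
    finally show ?thesis .
  qed
  finally have prod: "a ^ m * (w x * w x) * (2 * F x * a\<^sup>2 - 2 * n * \<alpha> * a - (\<alpha> * \<alpha> / 2 + \<alpha>) * G) \<le> 0" .
  have "w x * w x > 0" using wx by (simp flip: power2_eq_square)
  then have "a ^ m * (w x * w x) > 0" by (rule mult_pos_pos[OF zero_less_power[OF a]])
  with prod have "2 * F x * a\<^sup>2 - 2 * n * \<alpha> * a - (\<alpha> * \<alpha> / 2 + \<alpha>) * G \<le> 0"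
    unfolding mult_le_0_iff[of "a ^ m * (w x * w x)"] by linarith
  then have key: "2 * F x * a\<^sup>2 \<le> 2 * n * \<alpha> * a + (\<alpha> * \<alpha> / 2 + \<alpha>) * G"
    by linarith
  define y where "y k = x $ k - f x * p k x" for k
  have ry: "partial k r x = 2 * y k" for k
    by (simp add: partial_r y_def)
  have G: "G = 4 * (r x + (w x)\<^sup>2)" unfolding G_def by (rule gam_r_r)
  have Gy: "G = 4 * gdot (\<lambda>i. N i x) y y"
    unfolding G_def gam_def ry gdot_scale gdot_scale_right by simp
  have "n * (2 * \<kappa>)\<^sup>2 \<le> (n - 1) * (\<Sum>j\<in>UNIV. \<Sum>k\<in>UNIV. S j k x * S k j x)"
    unfolding n_def
  proof (rule eigenvalue_le_trace_square[where h = "\<lambda>i j. v x * H i j x" and v = "v x" and p = "\<lambda>i. p i x"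
        and n = "\<lambda>i. N i x" and y = y])
    show "v x * H i j x = v x * H j i x" for i j by (simp add: H_sym[of i])
    show "S i k x = (\<Sum>l\<in>UNIV. ginv (\<lambda>i. N i x) i l * (v x * H l k x))" for i k by (rule S_ginv)
    show "N k x = v x * p k x" for k by (rule N_def)
    show "(v x)\<^sup>2 = 1 + (\<Sum>k\<in>UNIV. (N k x)\<^sup>2)"
      using sum_N_square[of x] by (simp add: power2_eq_square)
    show "(\<Sum>j\<in>UNIV. S j j x) = 0" by (rule trace_S)
    show "(\<Sum>j\<in>UNIV. S j k x * y j) = 2 * \<kappa> * y k" for k
      using Dw[of k] unfolding ry partial_w y_def[symmetric] by simp
    show "gdot (\<lambda>i. N i x) y y \<noteq> 0"
      using Gy G r_nonneg[of x] wx by (auto simp: add_nonneg_eq_0_iff)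
  qed (rule card)
  then have "n * (\<alpha> * w x / a)\<^sup>2 \<le> (n - 1) * F x"
    by (simp add: F_def \<kappa>_def)
  then have "n * (\<alpha> * w x)\<^sup>2 \<le> (n - 1) * (F x * a\<^sup>2)"
    using a by (simp add: power_divide field_simps)
  also have "\<dots> \<le> (n - 1) * ((2 * n * \<alpha> * a + (\<alpha> * \<alpha> / 2 + \<alpha>) * G) / 2)"
    using key n by (intro mult_left_mono) auto
  also have "\<dots> = \<alpha> / 4 * ((2 * n * \<alpha> * a + (\<alpha> * \<alpha> / 2 + \<alpha>) * G) / 2)"
    by (simp add: alpha)
  finally have "\<alpha> * \<alpha> * (n * (w x)\<^sup>2) \<le> \<alpha> * \<alpha> * ((n * a + (\<alpha> + 2) * (r x + (w x)\<^sup>2)) / 4)"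
    unfolding G by (simp add: power2_eq_square field_simps)
  then have "n * (w x)\<^sup>2 \<le> (n * a + (\<alpha> + 2) * (r x + (w x)\<^sup>2)) / 4"
    by (rule mult_left_le_imp_le) (simp add: \<alpha>_def)
  then have "4 * n * (w x)\<^sup>2 \<le> n * a + (4 * n - 2) * (r x + (w x)\<^sup>2)"
    by (simp add: alpha)
  \<comment> \<open>as \<alpha> + 2 = 4 n - 2, a positive multiple of w^2 remains on the left\<close>
  then have "2 * (w x)\<^sup>2 \<le> n * a + (4 * n - 2) * r x"
    by (simp add: algebra_simps)
  also have "\<dots> \<le> (4 * n - 2) * a + (4 * n - 2) * r x"
    using n a by (intro add_right_mono mult_right_mono) auto
  also have "\<dots> = (4 * n - 2) * \<rho>" by (simp add: a_def algebra_simps)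
  finally show ?thesis by (simp add: n_def power2_eq_square algebra_simps)
qed

text \<open>The bound at the maximum is used with 2 \<rho>, so that the cutoff is at least \<rho> where r \<le> \<rho>.\<close>

lemma support_bound:
  assumes card: "CARD('n) \<ge> 2"
  obtains C where "C \<ge> 0" "\<And>\<rho> x. \<rho> > 0 \<Longrightarrow> r x \<le> \<rho> \<Longrightarrow> (w x)\<^sup>2 \<le> C * \<rho>"
proof -
  define m where "m = 4 * (CARD('n) - 1)"
  define c where "c = 2 * real CARD('n) - 1"
  have c: "c \<ge> 0" using card by (simp add: c_def)
  have "(w x)\<^sup>2 \<le> (2 ^ m * c * 2) * \<rho>" if \<rho>: "\<rho> > 0" and x: "r x \<le> \<rho>" for \<rho> x
  proof -
    have "(2 * \<rho> - r x) ^ m * (w x * w x) \<le> (2 * \<rho>) ^ m * (c * (2 * \<rho>))"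
    proof (rule cutoff_bound)
      show "continuous_on UNIV (\<lambda>x. w x * w x)"
        by (intro continuous_intros Ck_continuous[OF w_Ck])
      fix z assume z: "r z < 2 * \<rho>" "0 < w z * w z"
        "\<forall>\<^sub>F y in nhds z. (2 * \<rho> - r y) ^ m * (w y * w y) \<le> (2 * \<rho> - r z) ^ m * (w z * w z)"
      then have "w z * w z \<le> c * (2 * \<rho>)"
        unfolding m_def c_def by (intro support_bound_step[OF card]) auto
      then show "(2 * \<rho> - r z) ^ m * (w z * w z) \<le> (2 * \<rho>) ^ m * (c * (2 * \<rho>))"
        using z(1) r_nonneg[of z] \<rho> by (intro mult_mono[where b = "(2 * \<rho>) ^ m"] power_mono) auto
    qed (use \<rho> x card c in \<open>auto simp: m_def\<close>)
    moreover have "\<rho> ^ m * (w x * w x) \<le> (2 * \<rho> - r x) ^ m * (w x * w x)"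
      using \<rho> x by (intro mult_right_mono power_mono) auto
    ultimately have "\<rho> ^ m * (w x * w x) \<le> \<rho> ^ m * (2 ^ m * c * 2 * \<rho>)"
      by (simp add: power_mult_distrib mult_ac)
    then have "w x * w x \<le> 2 ^ m * c * 2 * \<rho>"
      by (rule mult_left_le_imp_le) (use \<rho> in simp)
    then show ?thesis by (simp add: power2_eq_square)
  qed
  then show ?thesis using c by (intro that[of "2 ^ m * c * 2"]) auto
qed

text \<open>At the maximum the quadratic growth in simons outweighs the terms from the cutoff, which are linear
  in F.\<close>

lemma curvature_bound_step:
  assumes rx: "r x < \<rho>" and Fx: "F x > 0"
    and max: "\<forall>\<^sub>F y in nhds x. (\<rho> - r y) ^ 2 * F y \<le> (\<rho> - r x) ^ 2 * F x"
  shows "(\<rho> - r x) ^ 2 * F x \<le> 2 * real CARD('n) * (\<rho> - r x) + 3 * gam N r r x"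
proof -
  define n where "n = real CARD('n)"
  define a where "a = \<rho> - r x"
  have a: "a > 0" using rx by (simp add: a_def)
  define G where "G = gam N r r x"
  let ?A = "\<lambda>x. (\<rho> - r x) ^ Suc (Suc 0)"
  note ck = Ck_power[OF cutoff_Ck[of \<rho>], where m = "Suc (Suc 0)"]
  have max': "\<forall>\<^sub>F y in nhds x. ?A y * F y \<le> ?A x * F x"
    using max by (simp add: power2_eq_square)
  have DF: "partial k F x = 2 * F x / a * partial k r x" for k
  proof -
    have "partial k (\<lambda>x. ?A x * F x) x = 0"
      by (rule lap_local_max(2)[OF Ck_mult[OF ck F_Ck] max'])
    then have "a * (a * partial k F x - 2 * F x * partial k r x) = 0"
      by (simp only: partial_mult[OF ck F_Ck] partial_power[OF cutoff_Ck] partial_cutoff a_def[symmetric])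
         (simp add: algebra_simps)
    then show ?thesis using a by (simp add: field_simps)
  qed
  have gAF: "gam N ?A F x = - (4 * F x * G)"
  proof -
    have "gam N ?A F x = gdot (\<lambda>i. N i x) (\<lambda>k. - (2 * a) * partial k r x) (\<lambda>k. 2 * F x / a * partial k r x)"
      unfolding gam_def partial_power[OF cutoff_Ck] partial_cutoff DF
      by (simp add: a_def algebra_simps)
    also have "\<dots> = - (2 * a) * (2 * F x / a * G)"
      unfolding gdot_scale gdot_scale_right G_def gam_def by simp
    finally show ?thesis using a by simp
  qed
  have lA: "lap N ?A x = - (4 * n * a) + 2 * G"
    unfolding lap_power[OF cutoff_Ck] lap_cutoff gam_cutoff by (simp add: n_def a_def G_def algebra_simps)
  have "lap N (\<lambda>x. ?A x * F x) x \<le> 0"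
    by (rule lap_local_max(1)[OF Ck_mult[OF ck F_Ck] max'])
  then have "a\<^sup>2 * lap N F x + F x * (- (4 * n * a) + 2 * G) - 8 * F x * G \<le> 0"
    unfolding lap_mult[OF ck F_Ck] lA gAF by (simp add: a_def power2_eq_square)
  moreover have "a\<^sup>2 * (2 * (F x)\<^sup>2) \<le> a\<^sup>2 * lap N F x"
    by (intro mult_left_mono simons) auto
  ultimately have "(2 * F x) * (a\<^sup>2 * F x) \<le> (2 * F x) * (2 * n * a + 3 * G)"
    by (simp add: algebra_simps power2_eq_square)
  then show ?thesis using Fx by (simp add: a_def n_def G_def)
qed

lemma F_zero:
  assumes card: "CARD('n) \<ge> 2"
  shows "F x = 0"
proof -
  obtain C where C: "C \<ge> 0" "\<And>\<rho> x. \<rho> > 0 \<Longrightarrow> r x \<le> \<rho> \<Longrightarrow> (w x)\<^sup>2 \<le> C * \<rho>"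
    using support_bound[OF card] by blast
  define D where "D = 2 * real CARD('n) + 12 + 12 * C"
  have D: "D \<ge> 0" using C(1) by (simp add: D_def)
  have decay: "(\<rho> - r x) ^ 2 * F x \<le> D * \<rho>" if \<rho>: "\<rho> > 0" and x: "r x \<le> \<rho>" for \<rho>
  proof (rule cutoff_bound[OF Ck_continuous[OF F_Ck] F_nonneg])
    fix z assume z: "r z < \<rho>" "0 < F z" "\<forall>\<^sub>F y in nhds z. (\<rho> - r y) ^ 2 * F y \<le> (\<rho> - r z) ^ 2 * F z"
    have "(\<rho> - r z) ^ 2 * F z \<le> 2 * real CARD('n) * (\<rho> - r z) + 3 * gam N r r z"
      by (rule curvature_bound_step[OF z])
    also have "\<dots> = 2 * real CARD('n) * (\<rho> - r z) + 12 * r z + 12 * (w z)\<^sup>2"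
      by (simp add: gam_r_r)
    also have "\<dots> \<le> 2 * real CARD('n) * \<rho> + 12 * \<rho> + 12 * (C * \<rho>)"
      using C(2)[OF \<rho>, of z] z(1) r_nonneg[of z] by (intro add_mono mult_left_mono) auto
    finally show "(\<rho> - r z) ^ 2 * F z \<le> D * \<rho>" by (simp add: D_def algebra_simps)
  qed (use D \<rho> x in auto)
  show ?thesis
  proof (rule ccontr)
    assume "F x \<noteq> 0"
    then have F: "F x > 0" using F_nonneg[of x] by simp
    \<comment> \<open>the decay estimate at \<rho> = t + r x is violated for this t\<close>
    define t where "t = 1 + r x + 2 * D / F x"
    have t: "t \<ge> 1 + r x" "t > 2 * D / F x" using D F r_nonneg[of x] by (auto simp: t_def)
    have tp: "t > 0" using t(1) r_nonneg[of x] by simp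
    have "t ^ 2 * F x \<le> D * (t + r x)"
      using decay[of "t + r x"] tp r_nonneg[of x] by simp
    also have "\<dots> \<le> D * (t + t)" using D t(1) by (intro mult_left_mono) auto
    finally have "t * (t * F x) \<le> t * (2 * D)" by (simp add: power2_eq_square algebra_simps)
    then have "t * F x \<le> 2 * D" using tp by simp
    then show False using t(2) F by (simp add: field_simps)
  qed
qed

lemma affine_if_vanishing_at_0:
  assumes card: "CARD('n) \<ge> 2"
  obtains e where "\<And>x. f x = e \<bullet> x"
proof -
  define e :: "real ^ 'n" where "e = (\<chi> i. p i 0)"
  have p0: "p i x = p i 0" for i x
    by (rule constant_if_partial_zero[OF p_Ck]) (simp add: partial_p F_eq_0D F_zero[OF card])
  define g where "g x = f x - (\<Sum>j\<in>UNIV. e $ j * x $ j)" for x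
  have g: "Ck (Suc 0) g"
    unfolding g_def[abs_def] by (intro Ck_diff Ck_sum Ck_mult Ck_const Ck_coord Ck_mono[OF f_Ck]) simp
  have "partial i g x = 0" for i x
  proof -
    have "partial i g x = p i x - (\<Sum>j\<in>UNIV. e $ j * (if i = j then 1 else 0))"
      unfolding g_def[abs_def]
      by (simp add: partial_diff[OF f_Ck Ck_sum[OF Ck_mult[OF Ck_const[of "Suc 0"] Ck_coord]]]
          partial_sum[OF Ck_mult[OF Ck_const[of "Suc 0"] Ck_coord]] partial_mult[OF Ck_const[of "Suc 0"] Ck_coord[of "Suc 0"]]
          partial_coord p_def)
    then show ?thesis
      by (simp add: p0[of i x] e_def if_distrib[of "\<lambda>x. _ * x"] cong: if_cong)
  qed
  then have "g x = g 0" for x by (rule constant_if_partial_zero[OF g])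
  then have "f x = e \<bullet> x" for x
    by (simp add: g_def f0 inner_vec_def)
  then show ?thesis by (rule that)
qed

end

end


section \<open>Light-like points\<close>

text \<open>Q t exp (-C t) does not increase for t \<ge> 0; negative t are reflected.\<close>

lemma gronwall_zero:
  fixes Q Q' :: "real \<Rightarrow> real"
  assumes Q: "\<And>t. (Q has_real_derivative Q' t) (at t)" and bound: "\<And>t. \<bar>t\<bar> \<le> T \<Longrightarrow> \<bar>Q' t\<bar> \<le> C * Q t"
    and nonneg: "\<And>t. Q t \<ge> 0" and 0: "Q 0 = 0" and t: "\<bar>t\<bar> \<le> T"
  shows "Q t = 0"
proof -
  have forward: "R t = 0" if R: "\<And>t. (R has_real_derivative R' t) (at t)"
    and Rb: "\<And>t. \<bar>t\<bar> \<le> T \<Longrightarrow> R' t \<le> C * R t" and Rn: "\<And>t. R t \<ge> 0" and R0: "R 0 = 0"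
    and t: "0 \<le> t" "t \<le> T" for R R' t
  proof -
    have "R t * exp (- C * t) \<le> R 0 * exp (- C * 0)"
    proof (rule DERIV_nonpos_imp_nonincreasing[OF t(1)], intro exI conjI)
      fix s assume s: "0 \<le> s" "s \<le> t"
      show "((\<lambda>s. R s * exp (- C * s)) has_real_derivative (R' s - C * R s) * exp (- C * s)) (at s)"
      proof -
        have "((\<lambda>s. exp (- C * s)) has_real_derivative - C * exp (- C * s)) (at s)"
          by (auto intro!: derivative_eq_intros)
        from DERIV_mult[OF R this] show ?thesis by (simp add: algebra_simps)
      qed
      show "(R' s - C * R s) * exp (- C * s) \<le> 0"
        using Rb[of s] s t by (intro mult_nonpos_nonneg) auto
    qed
    then have "R t * exp (- C * t) \<le> 0" by (simp add: R0)
    then have "R t \<le> 0" by (simp add: mult_le_0_iff)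
    then show ?thesis using Rn[of t] by simp
  qed
  show ?thesis
  proof (cases "t \<ge> 0")
    case True
    show ?thesis
    proof (rule forward[of Q Q', OF Q _ nonneg 0 True])
      show "Q' s \<le> C * Q s" if "\<bar>s\<bar> \<le> T" for s
        using bound[OF that] by linarith
    qed (use t in auto)
  next
    case False
    have "Q (- (- t)) = 0"
    proof (rule forward[of "\<lambda>t. Q (- t)" "\<lambda>t. - Q' (- t)"])
      show "((\<lambda>t. Q (- t)) has_real_derivative - Q' (- s)) (at s)" for s
        by (rule DERIV_mirror[THEN iffD1, OF Q])
      show "- Q' (- s) \<le> C * Q (- s)" if "\<bar>s\<bar> \<le> T" for s
        using bound[of "- s"] that by auto
    qed (use nonneg 0 t False in auto)
    then show ?thesis by simp
  qed
qed

lemma bounded_family: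
  fixes g :: "'k::finite \<Rightarrow> 'a::topological_space \<Rightarrow> real"
  assumes "compact K" "\<And>k. continuous_on K (g k)"
  obtains M where "M > 0" "\<And>k x. x \<in> K \<Longrightarrow> \<bar>g k x\<bar> \<le> M"
proof -
  have "compact ((\<lambda>x. \<Sum>k\<in>UNIV. \<bar>g k x\<bar>) ` K)"
    by (rule compact_continuous_image[OF continuous_on_sum[OF continuous_on_rabs[OF assms(2)]] assms(1)])
  then have "bounded ((\<lambda>x. \<Sum>k\<in>UNIV. \<bar>g k x\<bar>) ` K)"
    by (rule compact_imp_bounded)
  then obtain M where M: "\<And>x. x \<in> K \<Longrightarrow> norm (\<Sum>k\<in>UNIV. \<bar>g k x\<bar>) \<le> M"
    unfolding bounded_iff by fast
  have "\<bar>g k x\<bar> \<le> max M 1" if "x \<in> K" for k x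
  proof -
    have "\<bar>g k x\<bar> \<le> (\<Sum>k\<in>UNIV. \<bar>g k x\<bar>)"
      by (rule member_le_sum) auto
    then show ?thesis using M[OF that] by simp
  qed
  then show ?thesis by (intro that[of "max M 1"]) auto
qed

text \<open>For |s| \<le> 1 the value of u at distance s from x in direction i lies below the parabola
  u x + a s + M s^2 / 2 with a = partial i u x. The minimum of the parabola, at s = -a / M, cannot
  be negative; that |s| \<le> 1 there is ensured by letting M bound the first derivatives as well.\<close>

lemma gradient_square_le:
  fixes u :: "real ^ 'n \<Rightarrow> real"
  assumes u: "Ck (Suc (Suc k)) u" and nonneg: "\<And>x. u x \<ge> 0"
  obtains M where "M > 0" "\<And>x i. x \<in> cball x0 T \<Longrightarrow> (partial i u x)\<^sup>2 \<le> M * u x"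
proof -
  have c: "continuous_on (cball x0 (T + 1)) (partial i u)"
    "continuous_on (cball x0 (T + 1)) (partial i (partial i u))" for i
    using Ck_continuous[OF Ck_partial[OF u]] Ck_continuous[OF Ck_partial[OF Ck_partial[OF u]]]
    by (auto intro: continuous_on_subset)
  obtain M1 where M1: "M1 > 0" "\<And>i x. x \<in> cball x0 (T + 1) \<Longrightarrow> \<bar>partial i u x\<bar> \<le> M1"
    by (rule bounded_family[of "cball x0 (T + 1)" "\<lambda>i. partial i u", OF compact_cball c(1)]) (rule that)
  obtain M2 where M2: "M2 > 0" "\<And>i x. x \<in> cball x0 (T + 1) \<Longrightarrow> \<bar>partial i (partial i u) x\<bar> \<le> M2"
    by (rule bounded_family[of "cball x0 (T + 1)" "\<lambda>i. partial i (partial i u)", OF compact_cball c(2)]) (rule that)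
  define M where "M = max M1 M2"
  have M: "M > 0" "M1 \<le> M" "M2 \<le> M" using M1(1) by (auto simp: M_def)
  have "(partial i u x)\<^sup>2 \<le> 2 * M * u x" if x: "x \<in> cball x0 T" for x i
  proof (cases "partial i u x = 0")
    case True
    then show ?thesis using M nonneg[of x] by simp
  next
    case False
    define a where "a = partial i u x"
    define s where "s = - a / M"
    define g where "g m = (if m = 0 then (\<lambda>t. u (x + t *\<^sub>R axis i 1)) else if m = 1 then (\<lambda>t. partial i u (x + t *\<^sub>R axis i 1))
       else (\<lambda>t. partial i (partial i u) (x + t *\<^sub>R axis i 1)))" for m :: nat
    have x1: "x + t *\<^sub>R axis i 1 \<in> cball x0 (T + 1)" if "\<bar>t\<bar> \<le> 1" for t
    proof -
      have "norm (x0 - (x + t *\<^sub>R axis i 1)) \<le> norm (x0 - x) + norm (t *\<^sub>R axis i 1 :: real ^ 'n)"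
        using norm_triangle_ineq4[of "x0 - x" "t *\<^sub>R axis i 1"] by (simp add: algebra_simps)
      then show ?thesis using x that by (simp add: dist_norm norm_axis_1)
    qed
    have "\<bar>a\<bar> \<le> M"
      using M1(2)[OF x1[of 0], of i] M by (simp add: a_def)
    then have sM: "\<bar>s\<bar> \<le> 1"
      using M by (simp add: s_def abs_divide)
    have "s \<noteq> 0" using False M by (simp add: s_def a_def)
    with sM have s: "s \<noteq> 0" "-1 \<le> s" "s \<le> 1" by auto
    have "\<exists>t. (if s < 0 then s < t \<and> t < 0 else 0 < t \<and> t < s) \<and>
       u (x + s *\<^sub>R axis i 1) = (\<Sum>m<2. g m 0 / fact m * (s - 0) ^ m) + g 2 t / fact 2 * (s - 0) ^ 2"
    proof (rule Taylor[where a = "-1" and b = 1])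
      show "\<forall>m t. m < 2 \<and> -1 \<le> t \<and> t \<le> 1 \<longrightarrow> (g m has_real_derivative g (Suc m) t) (at t)"
        using has_partial[where x = x and i = i, OF u]
          has_partial[where x = x and i = i, OF Ck_partial[OF u, of i]]
        by (auto simp: g_def less_2_cases_iff)
    qed (use s in \<open>auto simp: g_def\<close>)
    then obtain t where t: "(if s < 0 then s < t \<and> t < 0 else 0 < t \<and> t < s)"
      "u (x + s *\<^sub>R axis i 1) = u x + a * s + g 2 t / 2 * s\<^sup>2"
      by (auto simp: g_def a_def eval_nat_numeral)
    have "\<bar>t\<bar> \<le> 1" using t(1) s by (auto split: if_splits)
    then have "g 2 t \<le> M" using M2(2)[OF x1, of t i] M by (simp add: g_def)
    then have "g 2 t / 2 * s\<^sup>2 \<le> M / 2 * s\<^sup>2" by (intro mult_right_mono) auto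
    then have "0 \<le> u x + a * s + M / 2 * s\<^sup>2"
      using nonneg[of "x + s *\<^sub>R axis i 1"] t(2) by linarith
    also have "\<dots> = u x - a\<^sup>2 / (2 * M)"
      using M by (simp add: s_def field_simps power2_eq_square)
    finally show ?thesis using M by (simp add: a_def field_simps)
  qed
  then show ?thesis using M by (intro that[of "2 * M"]) auto
qed

text \<open>Along the integral curves of Df the equation is a linear ordinary differential equation for B, and
  where B = 0 these curves have no acceleration. That suggests to look at the line through x0 with
  direction e, and to control together with B the deviation of Df from e.\<close>

lemma light_like_line:
  fixes f :: "real ^ 'n \<Rightarrow> real"
  assumes smooth: "Ck (Suc (Suc (Suc k))) f" and zmc: "\<And>x. A_fun f x = 0" and B: "\<And>x. B_fun f x \<ge> 0"
    and x0: "B_fun f x0 = 0"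
  defines "e \<equiv> (\<chi> i. partial i f x0)"
  shows "partial i f (x0 + t *\<^sub>R e) = e $ i"
proof -
  define p where "p i = partial i f" for i
  define H where "H i j = partial j (p i)" for i j
  have p: "Ck (Suc (Suc k)) (p i)" for i unfolding p_def by (rule Ck_partial[OF smooth])
  have B_eq: "B_fun f = (\<lambda>x. 1 - (\<Sum>i\<in>UNIV. (p i x)\<^sup>2))"
    by (simp add: B_fun_def fun_eq_iff p_def)
  have B_Ck: "Ck (Suc (Suc k)) (B_fun f)"
    unfolding B_eq by (intro Ck_diff Ck_const Ck_sum Ck_power p)
  have DB: "partial j (B_fun f) x = - 2 * (\<Sum>i\<in>UNIV. p i x * H i j x)" for j x
    unfolding B_eq by (simp add: partial_diff[OF Ck_const[of "Suc 0"] Ck_sum[OF Ck_power[OF p]]]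
       partial_sum[OF Ck_power[OF p]] partial_power[OF p] H_def sum_distrib_left mult_ac sum_negf)
  have H_sym: "H i j = H j i" for i j
    unfolding H_def p_def by (rule partial_commute[OF smooth])
  have eqn: "(\<Sum>j\<in>UNIV. p j x * partial j (B_fun f) x) = 2 * B_fun f x * (\<Sum>i\<in>UNIV. H i i x)" for x
  proof -
    have "A_fun f x = B_fun f x * (\<Sum>i\<in>UNIV. H i i x) + (\<Sum>i\<in>UNIV. \<Sum>j\<in>UNIV. p i x * p j x * H i j x)"
      by (simp add: A_fun_def p_def H_def distrib_right sum.distrib sum_distrib_left mult.assoc
          if_distrib[of "\<lambda>x. x * _"] if_distrib[of "\<lambda>x. _ * x"] cong: if_cong)
    moreover have "(\<Sum>j\<in>UNIV. p j x * partial j (B_fun f) x) = - 2 * (\<Sum>i\<in>UNIV. \<Sum>j\<in>UNIV. p i x * p j x * H i j x)"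
      unfolding DB by (subst sum.swap) (simp add: sum_distrib_left mult_ac)
    ultimately show ?thesis using zmc[of x] by simp
  qed
  define n where "n = real CARD('n)"
  have norm_e: "norm e = 1"
  proof -
    have "(norm e)\<^sup>2 = (\<Sum>i\<in>UNIV. p i x0 * p i x0)"
      by (simp only: power2_norm_eq_inner inner_vec_def inner_real_def e_def p_def vec_lambda_beta)
    then have "(norm e)\<^sup>2 = 1" using x0 unfolding B_eq by (simp add: power2_eq_square)
    then show ?thesis using norm_ge_zero[of e] by (simp only: power2_eq_1_iff) linarith
  qed
  define T where "T = \<bar>t\<bar>"
  obtain M1 where M1: "M1 > 0" "\<And>x i. x \<in> cball x0 T \<Longrightarrow> (partial i (B_fun f) x)\<^sup>2 \<le> M1 * B_fun f x"
    using gradient_square_le[OF B_Ck B] by blast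
  have "continuous_on (cball x0 T) (case ij of (i, j) \<Rightarrow> H i j)" for ij :: "'n \<times> 'n"
    using Ck_continuous[OF Ck_partial[OF p]] by (auto simp: H_def intro: continuous_on_subset split: prod.splits)
  then obtain M2 where "M2 > 0" "\<And>ij x. x \<in> cball x0 T \<Longrightarrow> \<bar>(case ij of (i, j) \<Rightarrow> H i j) x\<bar> \<le> M2"
    using bounded_family[OF compact_cball, of x0 T "\<lambda>ij. case ij of (i, j) \<Rightarrow> H i j"] by blast
  then have M2: "M2 > 0" "\<And>i j x. x \<in> cball x0 T \<Longrightarrow> \<bar>H i j x\<bar> \<le> M2" by fastforce+
  define \<gamma> where "\<gamma> s = x0 + s *\<^sub>R e" for s
  define \<epsilon> where "\<epsilon> i s = e $ i - p i (\<gamma> s)" for i s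
  define Q where "Q s = B_fun f (\<gamma> s) + (\<Sum>i\<in>UNIV. (\<epsilon> i s)\<^sup>2)" for s
  define Q' where "Q' s = (\<Sum>j\<in>UNIV. e $ j * partial j (B_fun f) (\<gamma> s))
       + (\<Sum>i\<in>UNIV. 2 * \<epsilon> i s * - (\<Sum>j\<in>UNIV. e $ j * H i j (\<gamma> s)))" for s
  have "Q t = 0"
  proof (rule gronwall_zero[of Q Q' T "2 * n * M2 + n * M1 + 1"])
    show "(Q has_real_derivative Q' s) (at s)" for s
    proof -
      have eps: "(\<epsilon> i has_real_derivative 0 - (\<Sum>j\<in>UNIV. e $ j * H i j (\<gamma> s))) (at s)" for i
        unfolding \<epsilon>_def[abs_def] \<gamma>_def H_def
        by (intro DERIV_diff DERIV_const has_derivative_line[OF p])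
      have "((\<lambda>s. (\<epsilon> i s)\<^sup>2) has_real_derivative 2 * \<epsilon> i s * - (\<Sum>j\<in>UNIV. e $ j * H i j (\<gamma> s))) (at s)" for i
        using DERIV_power[OF eps[of i], of 2] by (simp add: mult_ac)
      moreover have "((\<lambda>s. B_fun f (\<gamma> s)) has_real_derivative (\<Sum>j\<in>UNIV. e $ j * partial j (B_fun f) (\<gamma> s))) (at s)"
        unfolding \<gamma>_def by (rule has_derivative_line[OF B_Ck])
      ultimately show ?thesis
        unfolding Q_def[abs_def] Q'_def by (intro DERIV_add DERIV_sum)
    qed
    show "Q s \<ge> 0" for s
      unfolding Q_def by (intro add_nonneg_nonneg B sum_nonneg) auto
    show "Q 0 = 0"
      by (simp add: Q_def \<gamma>_def \<epsilon>_def x0 e_def p_def)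
    show "\<bar>t\<bar> \<le> T" by (simp add: T_def)
    fix s assume s: "\<bar>s\<bar> \<le> T"
    define x where "x = \<gamma> s"
    have x: "x \<in> cball x0 T"
      using s by (simp add: x_def \<gamma>_def dist_norm norm_e)
    define E where "E = (\<Sum>i\<in>UNIV. (\<epsilon> i s)\<^sup>2)"
    define b where "b j = partial j (B_fun f) x" for j
    have e: "e $ j = p j x + \<epsilon> j s" for j by (simp add: \<epsilon>_def x_def)
    have b: "b i = - 2 * (\<Sum>j\<in>UNIV. p j x * H i j x)" for i
    proof -
      have "(\<Sum>j\<in>UNIV. p j x * H j i x) = (\<Sum>j\<in>UNIV. p j x * H i j x)"
        by (intro sum.cong refl arg_cong2[where f = "(*)"] fun_cong[OF H_sym])
      then show ?thesis unfolding b_def DB by simp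
    qed
    have 1: "(\<Sum>j\<in>UNIV. e $ j * b j) = 2 * B_fun f x * (\<Sum>i\<in>UNIV. H i i x) + (\<Sum>j\<in>UNIV. \<epsilon> j s * b j)"
      using eqn[of x] by (simp add: e distrib_right sum.distrib b_def)
    have 2: "(\<Sum>j\<in>UNIV. e $ j * H i j x) = - b i / 2 + (\<Sum>j\<in>UNIV. \<epsilon> j s * H i j x)" for i
      by (simp add: e distrib_right sum.distrib b)
    have Q': "Q' s = 2 * B_fun f x * (\<Sum>i\<in>UNIV. H i i x) + (\<Sum>j\<in>UNIV. 2 * \<epsilon> j s * b j)
        - (\<Sum>i\<in>UNIV. \<Sum>j\<in>UNIV. 2 * \<epsilon> i s * \<epsilon> j s * H i j x)"
    proof -
      have "Q' s = (\<Sum>j\<in>UNIV. e $ j * b j) + (\<Sum>i\<in>UNIV. 2 * \<epsilon> i s * - (\<Sum>j\<in>UNIV. e $ j * H i j x))"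
        by (simp only: Q'_def b_def x_def)
      also have "\<dots> = 2 * B_fun f x * (\<Sum>i\<in>UNIV. H i i x) + (\<Sum>j\<in>UNIV. \<epsilon> j s * b j)
         + (\<Sum>i\<in>UNIV. \<epsilon> i s * b i - (\<Sum>j\<in>UNIV. 2 * \<epsilon> i s * \<epsilon> j s * H i j x))"
        unfolding 1 2 by (simp add: algebra_simps sum_distrib_left)
      also have "\<dots> = 2 * B_fun f x * (\<Sum>i\<in>UNIV. H i i x) + (\<Sum>j\<in>UNIV. 2 * \<epsilon> j s * b j)
        - (\<Sum>i\<in>UNIV. \<Sum>j\<in>UNIV. 2 * \<epsilon> i s * \<epsilon> j s * H i j x)"
        by (simp add: sum_subtractf mult.assoc flip: sum_distrib_left)
      finally show ?thesis .
    qed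
    have i1: "\<bar>2 * B_fun f x * (\<Sum>i\<in>UNIV. H i i x)\<bar> \<le> 2 * n * M2 * B_fun f x"
    proof -
      have "\<bar>\<Sum>i\<in>UNIV. H i i x\<bar> \<le> n * M2"
        unfolding n_def using sum_bounded_above[of UNIV "\<lambda>i. \<bar>H i i x\<bar>" M2] M2(2)[OF x]
        by (intro order_trans[OF sum_abs]) simp
      then have "2 * B_fun f x * \<bar>\<Sum>i\<in>UNIV. H i i x\<bar> \<le> 2 * B_fun f x * (n * M2)"
        using B[of x] by (intro mult_left_mono) auto
      then show ?thesis using B[of x] by (simp add: abs_mult mult_ac)
    qed
    have i2: "\<bar>\<Sum>j\<in>UNIV. 2 * \<epsilon> j s * b j\<bar> \<le> E + n * M1 * B_fun f x"
    proof -
      have "\<bar>2 * \<epsilon> j s * b j\<bar> \<le> (\<epsilon> j s)\<^sup>2 + M1 * B_fun f x" for j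
      proof -
        have "0 \<le> (\<bar>\<epsilon> j s\<bar> - \<bar>b j\<bar>)\<^sup>2" by simp
        then have "\<bar>2 * \<epsilon> j s * b j\<bar> \<le> (\<epsilon> j s)\<^sup>2 + (b j)\<^sup>2"
          by (simp add: power2_diff abs_mult mult_ac)
        then show ?thesis using M1(2)[OF x, of j] by (simp add: b_def)
      qed
      then have "\<bar>\<Sum>j\<in>UNIV. 2 * \<epsilon> j s * b j\<bar> \<le> (\<Sum>j\<in>UNIV. (\<epsilon> j s)\<^sup>2 + M1 * B_fun f x)"
        by (intro order_trans[OF sum_abs] sum_mono) auto
      then show ?thesis by (simp add: sum.distrib E_def n_def)
    qed
    have i3: "\<bar>\<Sum>i\<in>UNIV. \<Sum>j\<in>UNIV. 2 * \<epsilon> i s * \<epsilon> j s * H i j x\<bar> \<le> 2 * n * M2 * E"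
    proof -
      have "\<bar>2 * \<epsilon> i s * \<epsilon> j s * H i j x\<bar> \<le> M2 * (\<epsilon> i s)\<^sup>2 + M2 * (\<epsilon> j s)\<^sup>2" for i j
      proof -
        have "0 \<le> (\<bar>\<epsilon> i s\<bar> - \<bar>\<epsilon> j s\<bar>)\<^sup>2" by simp
        then have "\<bar>2 * \<epsilon> i s * \<epsilon> j s\<bar> \<le> (\<epsilon> i s)\<^sup>2 + (\<epsilon> j s)\<^sup>2"
          by (simp add: power2_diff abs_mult mult_ac)
        then have "\<bar>2 * \<epsilon> i s * \<epsilon> j s\<bar> * \<bar>H i j x\<bar> \<le> ((\<epsilon> i s)\<^sup>2 + (\<epsilon> j s)\<^sup>2) * M2"
          using M2(2)[OF x, of i j] by (intro mult_mono) auto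
        then show ?thesis by (simp add: abs_mult algebra_simps)
      qed
      then have "\<bar>\<Sum>i\<in>UNIV. \<Sum>j\<in>UNIV. 2 * \<epsilon> i s * \<epsilon> j s * H i j x\<bar>
         \<le> (\<Sum>i\<in>UNIV. \<Sum>j\<in>UNIV. M2 * (\<epsilon> i s)\<^sup>2 + M2 * (\<epsilon> j s)\<^sup>2)"
        by (rule order_trans[OF sum_abs sum_mono[OF order_trans[OF sum_abs sum_mono]]])
      also have "\<dots> = 2 * n * M2 * E"
        by (simp add: sum.distrib E_def n_def algebra_simps flip: sum_distrib_left)
      finally show ?thesis .
    qed
    have E: "E \<ge> 0" unfolding E_def by (intro sum_nonneg) auto
    have "\<bar>Q' s\<bar> \<le> 2 * n * M2 * B_fun f x + (E + n * M1 * B_fun f x) + 2 * n * M2 * E"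
      using i1 i2 i3 unfolding Q' by linarith
    also have "\<dots> = (2 * n * M2 + n * M1) * B_fun f x + (2 * n * M2 + 1) * E"
      by (simp add: algebra_simps)
    also have "\<dots> \<le> (2 * n * M2 + n * M1 + 1) * B_fun f x + (2 * n * M2 + n * M1 + 1) * E"
    proof -
      have "n * M1 \<ge> 0" using M1(1) by (simp add: n_def)
      then show ?thesis
        by (intro add_mono[OF mult_right_mono mult_right_mono] E B) auto
    qed
    also have "\<dots> = (2 * n * M2 + n * M1 + 1) * Q s"
      by (simp add: Q_def E_def x_def algebra_simps)
    finally show "\<bar>Q' s\<bar> \<le> (2 * n * M2 + n * M1 + 1) * Q s" .
  qed
  then have "(\<Sum>i\<in>UNIV. (\<epsilon> i t)\<^sup>2) = 0"
    using B[of "\<gamma> t"] sum_nonneg[of UNIV "\<lambda>i. (\<epsilon> i t)\<^sup>2"] unfolding Q_def by simp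
  then have "\<epsilon> i t = 0" by (simp add: sum_nonneg_eq_0_iff)
  then show ?thesis by (simp add: \<epsilon>_def \<gamma>_def p_def)
qed

text \<open>From the points of the line, which extends in both directions, the Lipschitz condition gives
  (f x - f x0 - t)^2 \<le> |x - x0 - t e|^2 for all t. The squares of t cancel, and the remaining
  expression is linear in t and bounded above, hence constant.\<close>

lemma affine_if_light_like_point:
  fixes f :: "real ^ 'n \<Rightarrow> real"
  assumes smooth: "Ck (Suc (Suc (Suc k))) f" and zmc: "\<And>x. A_fun f x = 0" and B: "\<And>x. B_fun f x \<ge> 0"
    and x0: "B_fun f x0 = 0"
  obtains e c where "\<And>x. f x = c + e \<bullet> x"
proof -
  define e where "e = (\<chi> i. partial i f x0)"
  have De: "partial i f (x0 + t *\<^sub>R e) = e $ i" for i t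
    unfolding e_def by (rule light_like_line[OF smooth zmc B x0])
  have "e \<bullet> e = (\<Sum>i\<in>UNIV. (partial i f x0)\<^sup>2)"
    by (simp add: inner_vec_def e_def power2_eq_square)
  then have ee: "e \<bullet> e = 1" using x0 by (simp add: B_fun_def)
  have line: "f (x0 + t *\<^sub>R e) = f x0 + t" for t
  proof -
    have "((\<lambda>t. f (x0 + t *\<^sub>R e) - t) has_real_derivative 0) (at s)" for s
      using has_derivative_line[OF smooth, of x0 e s] ee
      by (auto intro!: derivative_eq_intros simp: De inner_vec_def)
    then have "f (x0 + t *\<^sub>R e) - t = f (x0 + 0 *\<^sub>R e) - 0"
      by (intro DERIV_isconst_all[of "\<lambda>t. f (x0 + t *\<^sub>R e) - t"]) auto
    then show ?thesis by simp
  qed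
  have "f x = (f x0 - e \<bullet> x0) + e \<bullet> x" for x
  proof -
    define y where "y = x - x0"
    define s where "s = f x - f x0"
    define d where "d = e \<bullet> y - s"
    have key: "2 * t * d \<le> y \<bullet> y - s\<^sup>2" for t
    proof -
      obtain z where "(f x - f (x0 + t *\<^sub>R e))\<^sup>2 \<le> (norm (x - (x0 + t *\<^sub>R e)))\<^sup>2 * (1 - B_fun f z)"
        using increment_le[OF smooth] by blast
      also have "\<dots> \<le> (norm (x - (x0 + t *\<^sub>R e)))\<^sup>2 * 1"
        using B[of z] by (intro mult_left_mono) auto
      also have "x - (x0 + t *\<^sub>R e) = y - t *\<^sub>R e" by (simp add: y_def)
      also have "(norm (y - t *\<^sub>R e))\<^sup>2 * 1 = y \<bullet> y - 2 * t * (e \<bullet> y) + t * t"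
        by (simp add: power2_norm_eq_inner inner_diff_left inner_diff_right ee inner_commute[of y e] algebra_simps)
      finally have "(s - t)\<^sup>2 \<le> y \<bullet> y - 2 * t * (e \<bullet> y) + t * t"
        by (simp add: line s_def diff_diff_eq)
      then show ?thesis by (simp add: d_def power2_eq_square algebra_simps)
    qed
    have "d = 0"
    proof (rule ccontr)
      assume "d \<noteq> 0"
      then show False using key[of "(y \<bullet> y - s\<^sup>2 + 1) / (2 * d)"] by simp
    qed
    then show ?thesis by (simp add: d_def s_def y_def inner_diff_right)
  qed
  then show ?thesis by (rule that)
qed

section \<open>The Bernstein theorem\<close>

lemma affine_hyperplane_graph:
  fixes f :: "real ^ 'n \<Rightarrow> real"
  assumes "\<And>x. f x = c + e \<bullet> x"
  shows "affine_hyperplane (graph_on UNIV f)"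
  unfolding affine_hyperplane_def
proof (intro exI conjI)
  show "(- e, 1 :: real) \<noteq> 0" by (simp add: zero_prod_def)
  show "graph_on UNIV f = {p. (- e, 1) \<bullet> p = c}"
  proof (rule set_eqI)
    fix q :: "(real ^ 'n) \<times> real"
    obtain x s where q: "q = (x, s)" by (cases q)
    have "(- e, 1) \<bullet> q = c \<longleftrightarrow> s = f x"
      unfolding q assms[of x] by (auto simp: inner_prod_def)
    then show "q \<in> graph_on UNIV f \<longleftrightarrow> q \<in> {p. (- e, 1) \<bullet> p = c}"
      by (auto simp: graph_on_def q)
  qed
qed

lemma affine_if_space_like:
  fixes f :: "real ^ 'n \<Rightarrow> real"
  assumes card: "CARD('n) \<ge> 2" and smooth: "Ck 4 f" and zmc: "\<And>x. A_fun f x = 0" and B: "\<And>x. B_fun f x > 0"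
  obtains e c where "\<And>x. f x = c + e \<bullet> x"
proof -
  define g where "g x = f x - f 0" for x
  have f1: "Ck (Suc 0) f" using smooth by (rule Ck_mono) simp
  have Dg: "partial i g = partial i f" for i
    unfolding g_def[abs_def] by (simp add: partial_diff[OF f1 Ck_const[of "Suc 0"]])
  have "maximal_graph g"
  proof
    show "Ck 4 g" unfolding g_def[abs_def] by (intro Ck_diff smooth Ck_const)
    show "A_fun g x = 0" for x using zmc[of x] by (simp add: A_fun_def B_fun_def Dg)
    show "B_fun g x > 0" for x using B[of x] by (simp add: B_fun_def Dg)
  qed
  moreover have "g 0 = 0" by (simp add: g_def)
  ultimately obtain e where e: "\<And>x. g x = e \<bullet> x"
    using card by (rule maximal_graph.affine_if_vanishing_at_0) (rule that)
  have "f x = f 0 + e \<bullet> x" for x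
    using e[of x] by (simp add: g_def)
  then show ?thesis by (rule that)
qed

theorem theoremA:
  fixes f :: "real ^ 'n \<Rightarrow> real"
  assumes "CARD('n) \<ge> 2"
    and "Ck_on 4 UNIV f"
    and "zmc_graph_on UNIV f"
    and "\<not> (\<exists>x. time_like_point f x)"
  shows "affine_hyperplane (graph_on UNIV f)"
proof -
  have zmc: "A_fun f x = 0" for x using assms(3) by (simp add: zmc_graph_on_def)
  have B: "B_fun f x \<ge> 0" for x using assms(4) by (auto simp: time_like_point_def not_less)
  obtain e c where "\<And>x. f x = c + e \<bullet> x"
  proof (cases "\<exists>x0. B_fun f x0 = 0")
    case True
    then obtain x0 where x0: "B_fun f x0 = 0" ..
    have C3: "Ck (Suc (Suc (Suc 0))) f" using assms(2) by (rule Ck_mono) simp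
    show ?thesis by (rule affine_if_light_like_point[OF C3 zmc B x0]) (rule that)
  next
    case False
    then have "B_fun f x \<noteq> 0" for x by blast
    then have pos: "B_fun f x > 0" for x using B[of x] by (simp add: order_less_le)
    show ?thesis by (rule affine_if_space_like[OF assms(1,2) zmc pos]) (rule that)
  qed
  then show ?thesis by (rule affine_hyperplane_graph)
qed

end
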